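(* Let $p$ be an odd prime. Then the cyclic group $\mathbb{Z}_{2p}$ of order $2p$ is a $\mathrm{BCI}$-group.
   Context: Graphs are finite, simple and undirected. For a finite group $G$ and a subset $S\subseteq G$, the bi-Cayley graph $\mathrm{BCay}(G,S)$ has vertex set $G\times\{1,2\}$ and edge set $\{\{(g,1),(sg,2)\}\mid g\in G,\ s\in S\}$. It is a $\mathrm{BCI}$-graph if whenever $\mathrm{BCay}(G,S)\cong\mathrm{BCay}(G,T)$ for some $T\subseteq G$, then $T=gS^{\alpha}$ for some $g\in G$ and $\alpha\in\mathrm{Aut}(G)$, where $S^\alpha$ is the image of $S$ under $\alpha$. A group $G$ is a $\mathrm{BCI}$-group if every bi-Cayley graph over $G$ is a $\mathrm{BCI}$-graph. *)

theory Defs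
  imports
    "Graph_Theory.Pair_Digraph"
    "Graph_Theory.Digraph_Isomorphism"
    "HOL-Algebra.Bij"
    "HOL-Algebra.Elementary_Groups"
    "HOL-Computational_Algebra.Primes"
begin

text \<open>An undirected graph is represented, as usual in \<open>Graph_Theory\<close>, by a symmetric digraph: an
  edge \<open>{u, v}\<close> is the pair of arcs \<open>(u, v)\<close> and \<open>(v, u)\<close>. The lemmas below relate this encoding
  to edge sets of unordered pairs and to adjacency-preserving bijections.\<close>

definition bi_cayley :: "('a, 'b) monoid_scheme \<Rightarrow> 'a set \<Rightarrow> ('a \<times> nat) pair_pre_digraph"
  where "bi_cayley G S =
    \<lparr> pverts = carrier G \<times> {1, 2},
      parcs = (\<Union>g \<in> carrier G. \<Union>s \<in> S.
        {((g, 1), (s \<otimes>\<^bsub>G\<^esub> g, 2)), ((s \<otimes>\<^bsub>G\<^esub> g, 2), (g, 1))}) \<rparr>"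

definition bci_graph :: "('a, 'b) monoid_scheme \<Rightarrow> 'a set \<Rightarrow> bool"
  where "bci_graph G S \<longleftrightarrow>
    (\<forall>T \<subseteq> carrier G. digraph_iso (bi_cayley G S) (bi_cayley G T) \<longrightarrow>
      (\<exists>g \<in> carrier G. \<exists>\<alpha> \<in> auto G. T = g <#\<^bsub>G\<^esub> (\<alpha> ` S)))"

definition bci_group :: "('a, 'b) monoid_scheme \<Rightarrow> bool"
  where "bci_group G \<longleftrightarrow>
    group G \<and> finite (carrier G) \<and> (\<forall>S \<subseteq> carrier G. bci_graph G S)"

lemma pair_graph_bi_cayley:
  assumes "group G" "finite (carrier G)" "S \<subseteq> carrier G"
  shows "pair_graph (bi_cayley G S)"
proof -
  interpret group G by fact
  have sub: "parcs (bi_cayley G S) \<subseteq> pverts (bi_cayley G S) \<times> pverts (bi_cayley G S)"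
    using assms(3) by (auto simp: bi_cayley_def)
  have fin: "finite (pverts (bi_cayley G S))"
    using assms(2) by (simp add: bi_cayley_def)
  show ?thesis
  proof unfold_locales
    show "finite (parcs (bi_cayley G S))"
      using finite_subset[OF sub] fin by blast
    show "symmetric (with_proj (bi_cayley G S))"
      by (auto simp: symmetric_def sym_def bi_cayley_def)
  qed (use assms(3) fin in \<open>auto simp: bi_cayley_def\<close>)
qed

lemma edges_bi_cayley:
  "{{u, v} | u v. (u, v) \<in> parcs (bi_cayley G S)} =
    {{(g, 1), (s \<otimes>\<^bsub>G\<^esub> g, 2)} | g s. g \<in> carrier G \<and> s \<in> S}"
  by (simp add: bi_cayley_def) blast

lemma digraph_iso_with_proj_iff:
  assumes "pair_wf_digraph A" "pair_wf_digraph B"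
  shows "digraph_iso (with_proj A) (with_proj B) \<longleftrightarrow>
    (\<exists>f. bij_betw f (pverts A) (pverts B) \<and>
      (\<forall>u \<in> pverts A. \<forall>v \<in> pverts A. (u, v) \<in> parcs A \<longleftrightarrow> (f u, f v) \<in> parcs B))"
    (is "?L \<longleftrightarrow> ?R")
proof
  interpret A: pair_wf_digraph A by fact
  assume ?L
  then obtain h where h: "pre_digraph.digraph_isomorphism (with_proj A) h"
    and B: "with_proj B = app_iso h (with_proj A)"
    by (auto simp: digraph_iso_def)
  let ?f = "iso_verts h"
  have tl: "iso_tail h = fst" and hd: "iso_head h = snd"
    and vB: "pverts B = ?f ` pverts A" and aB: "parcs B = iso_arcs h ` parcs A"
    using B by (auto simp: app_iso_def with_proj_def)
  have inj: "inj_on ?f (pverts A)"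
    and arc: "\<And>u v. (u, v) \<in> parcs A \<Longrightarrow> iso_arcs h (u, v) = (?f u, ?f v)"
    using h by (fastforce simp: pre_digraph.digraph_isomorphism_def tl hd prod_eq_iff)+
  have "(u, v) \<in> parcs A \<longleftrightarrow> (?f u, ?f v) \<in> parcs B"
    if "u \<in> pverts A" "v \<in> pverts A" for u v
  proof
    assume "(?f u, ?f v) \<in> parcs B"
    then obtain x y where xy: "(x, y) \<in> parcs A" "iso_arcs h (x, y) = (?f u, ?f v)"
      by (auto simp: aB)
    then have "?f x = ?f u" "?f y = ?f v"
      by (auto simp: arc)
    with xy(1) that inj show "(u, v) \<in> parcs A"
      by (metis A.in_arcsD1 A.in_arcsD2 inj_onD)
  qed (metis aB arc image_eqI)
  then show ?R
    using inj vB by (auto simp: bij_betw_def)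
next
  interpret A: pair_wf_digraph A by fact
  interpret B: pair_wf_digraph B by fact
  assume ?R
  then obtain f where f: "inj_on f (pverts A)" "f ` pverts A = pverts B"
    and e: "\<And>u v. \<lbrakk>u \<in> pverts A; v \<in> pverts A\<rbrakk> \<Longrightarrow>
      (u, v) \<in> parcs A \<longleftrightarrow> (f u, f v) \<in> parcs B"
    by (auto simp: bij_betw_def)
  let ?h = "\<lparr> iso_verts = f, iso_arcs = map_prod f f, iso_head = snd, iso_tail = fst \<rparr>"
  have "inj_on (map_prod f f) (parcs A)"
  proof (rule inj_onI, clarsimp)
    fix u v x y assume "(u, v) \<in> parcs A" "(x, y) \<in> parcs A" "f u = f x" "f v = f y"
    then show "u = x \<and> v = y"
      using f(1) by (meson A.in_arcsD1 A.in_arcsD2 inj_onD)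
  qed
  moreover have "parcs B = map_prod f f ` parcs A"
  proof (intro equalityI subsetI)
    fix a assume a: "a \<in> parcs B"
    obtain u v where uv: "a = (u, v)"
      by (rule prod.exhaust)
    then have "u \<in> f ` pverts A" "v \<in> f ` pverts A"
      using a B.in_arcsD1 B.in_arcsD2 by (simp_all add: f(2))
    then obtain x y where xy: "u = f x" "v = f y" "x \<in> pverts A" "y \<in> pverts A"
      by blast
    then have "(x, y) \<in> parcs A"
      using a uv e[OF xy(3,4)] by simp
    then show "a \<in> map_prod f f ` parcs A"
      using uv xy(1,2) by (metis image_eqI map_prod_simp)
  next
    fix a assume "a \<in> map_prod f f ` parcs A"
    then obtain x y where xy: "(x, y) \<in> parcs A" "a = (f x, f y)"
      by auto
    then show "a \<in> parcs B"
      using e[OF A.in_arcsD1[OF xy(1)] A.in_arcsD2[OF xy(1)]] by simp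
  qed
  moreover have "wf_digraph (with_proj A)"
    by unfold_locales
  ultimately have "pre_digraph.digraph_isomorphism (with_proj A) ?h"
    and "with_proj B = app_iso ?h (with_proj A)"
    using f by (simp_all add: pre_digraph.digraph_isomorphism_def app_iso_def with_proj_def)
  then show ?L
    unfolding digraph_iso_def by blast
qed

end

theory Submission
  imports Defs "HOL-Algebra.Sylow" "HOL-Algebra.Group_Action" "HOL-Algebra.Multiplicative_Group"
    "HOL-Number_Theory.Cong"
begin

text \<open>
  Babai's conjugation argument. Flipping connected components by the maps \<open>(x, i) \<mapsto> (t - x, 3 - i)\<close>
  makes an isomorphism \<open>f\<close> from \<open>BCay(S)\<close> to \<open>BCay(T)\<close> preserve the two sides. Let \<open>a\<close> be the
  translation by 2, of order \<open>p\<close>. Both \<open>a\<close> and \<open>f\<inverse> a f\<close> are side-preserving automorphisms of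
  \<open>BCay(S)\<close>, so by Sylow's theorem some conjugate of the latter lies in a common \<open>p\<close>-subgroup with
  \<open>a\<close>. Each side has \<open>2 p < p\<^sup>2\<close> vertices, so the orbits of this subgroup are those of \<open>a\<close>, and on
  each of them the conjugate is a power of \<open>a\<close>. Hence, after composing with an automorphism, \<open>f\<close> is
  affine on each parity class of each side. If the slopes on two classes differ, the
  bipartite graph between them is complete or empty; otherwise slopes and intercepts match, and in
  every case one affine map of \<open>\<int>\<^sub>2\<^sub>p\<close> takes \<open>S\<close> to \<open>T\<close>.
\<close>

section \<open>Conjugating elements of prime order\<close>

lemma (in group_action) prime_power_orbit:
  assumes "prime (p::nat)" "order G = p ^ k" "w \<in> E"
  shows "\<exists>j. card (orbit G \<phi> w) = p ^ j"
  using orbit_stabilizer_theorem[OF assms(3)] assms(1,2)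
  by (metis divides_primepow_nat dvd_triv_left)

text \<open>Orbits have p-power size. Without a fixed point every orbit size would be divisible by
  \<open>p\<close>, and so would their sum \<open>card E\<close>.\<close>

lemma (in group_action) prime_power_fixed_point:
  assumes p: "prime (p::nat)" "order G = p ^ k" and E: "finite E" "\<not> p dvd card E"
  obtains w where "w \<in> E" "\<And>g. g \<in> carrier G \<Longrightarrow> \<phi> g w = w"
proof -
  have "\<exists>w\<in>E. card (orbit G \<phi> w) = 1"
  proof (rule ccontr)
    assume no: "\<not> ?thesis"
    have "p dvd card B" if "B \<in> orbits G E \<phi>" for B
    proof -
      obtain w where w: "w \<in> E" "B = orbit G \<phi> w"
        using \<open>B \<in> orbits G E \<phi>\<close> by (auto simp: orbits_def)
      then obtain j where j: "card B = p ^ j"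
        using prime_power_orbit[OF p] by blast
      then have "j \<noteq> 0"
        using no w by auto
      then show ?thesis
        by (simp add: j dvd_power)
    qed
    then have "p dvd (\<Sum>B\<in>orbits G E \<phi>. card B)"
      by (rule dvd_sum)
    then show False
      using E disjoint_sum[OF E(1), of "\<lambda>_. 1::nat"] by simp
  qed
  then obtain w where w: "w \<in> E" "card (orbit G \<phi> w) = 1"
    by blast
  then have "orbit G \<phi> w = {w}"
    using orbit_refl by (metis card_1_singletonE singletonD)
  then show thesis
    using w that[of w] by (auto simp: orbit_def)
qed

text \<open>Multiplying by the inverse on the right turns translation of right cosets into a left
  action; the restriction makes each map an element of \<open>BijGroup\<close>.\<close>

lemma (in group) rcosets_action:
  assumes H: "subgroup H G"
  shows "group_action G (rcosets H) (\<lambda>g. \<lambda>R\<in>rcosets H. R #> inv g)"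
proof -
  interpret subgroup H G by fact
  have sub: "R \<subseteq> carrier G" if "R \<in> rcosets H" for R
    using that rcosets_carrier[OF is_group] by blast
  have cl: "R #> g \<in> rcosets H" if "R \<in> rcosets H" "g \<in> carrier G" for R g
    using that subset by (auto simp: RCOSETS_def coset_mult_assoc)
  have bij: "bij_betw (\<lambda>R\<in>rcosets H. R #> g) (rcosets H) (rcosets H)"
    if g: "g \<in> carrier G" for g
    by (rule bij_betw_byWitness[where f' = "\<lambda>R\<in>rcosets H. R #> inv g"])
      (use g in \<open>auto simp: cl sub coset_mult_assoc\<close>)
  show ?thesis
    unfolding group_action_def group_hom_def group_hom_axioms_def
  proof (intro conjI is_group group_BijGroup homI)
    fix g assume "g \<in> carrier G"
    then show "(\<lambda>R\<in>rcosets H. R #> inv g) \<in> carrier (BijGroup (rcosets H))"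
      using bij[of "inv g"] by (simp add: BijGroup_def Bij_def)
  next
    fix g h assume g: "g \<in> carrier G" and h: "h \<in> carrier G"
    then show "(\<lambda>R\<in>rcosets H. R #> inv (g \<otimes> h)) =
      (\<lambda>R\<in>rcosets H. R #> inv g) \<otimes>\<^bsub>BijGroup (rcosets H)\<^esub> (\<lambda>R\<in>rcosets H. R #> inv h)"
      using bij[of "inv g"] bij[of "inv h"]
      by (auto simp: BijGroup_def Bij_def compose_def cl sub coset_mult_assoc inv_mult_group
          intro!: restrict_ext)
  qed
qed

text \<open>The element may be the identity, so its order is 1 or \<open>p\<close>. Either way it is
  positive, which is why natural exponents already give the whole generated subgroup.\<close>

lemma (in group) order_generate_prime:
  assumes p: "prime (p::nat)" and x: "x \<in> carrier G" "x [^] p = \<one>"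
  shows "\<exists>k. order (G\<lparr>carrier := generate G {x}\<rparr>) = p ^ k"
    and "generate G {x} = {x [^] n | n::nat. True}"
proof -
  have "ord x dvd p"
    using x pow_eq_id by simp
  then have o: "ord x = p ^ 0 \<or> ord x = p ^ 1"
    using p by (auto simp: prime_nat_iff)
  moreover have "order (G\<lparr>carrier := generate G {x}\<rparr>) = ord x"
    by (simp add: order_def generate_pow_card[OF x(1)])
  ultimately show "\<exists>k. order (G\<lparr>carrier := generate G {x}\<rparr>) = p ^ k"
    by metis
  have "ord x > 0"
    using o p prime_gt_0_nat by auto
  then show "generate G {x} = {x [^] n | n::nat. True}"
    using generate_pow_nat[OF x(1)] by auto
qed

text \<open>The group generated by \<open>x\<close> is a p-group acting on a number of cosets prime
  to \<open>p\<close>, so it fixes some coset \<open>H #> g\<close>. That \<open>x\<close> fixes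
  this coset says that \<open>g\<close> conjugates \<open>x\<close> into \<open>H\<close>. With
  \<open>H\<close> a Sylow p-subgroup this serves as the conjugacy part of Sylow's theorems.\<close>

lemma (in group) prime_order_conjugate_in_subgroup:
  assumes fin: "finite (carrier G)" and H: "subgroup H G" and p: "prime (p::nat)"
    and ndvd: "\<not> p dvd card (rcosets H)"
    and x: "x \<in> carrier G" "x [^] p = \<one>"
  obtains g where "g \<in> carrier G" "g \<otimes> x \<otimes> inv g \<in> H"
proof -
  let ?\<phi> = "\<lambda>g. \<lambda>R\<in>rcosets H. R #> inv g"
  interpret subgroup H G by fact
  obtain k where k: "order (G\<lparr>carrier := generate G {x}\<rparr>) = p ^ k"
    using order_generate_prime(1)[OF p x] by blast
  interpret A: group_action "G\<lparr>carrier := generate G {x}\<rparr>" "rcosets H" ?\<phi>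
    using group_action.induced_action[OF rcosets_action[OF H] generate_is_subgroup, of "{x}"] x
    by simp
  have "finite (rcosets H)"
    by (rule finite_subset[OF rcosets_subset_PowG[OF H]]) (simp add: fin)
  then obtain R where R: "R \<in> rcosets H" "\<And>y. y \<in> generate G {x} \<Longrightarrow> ?\<phi> y R = R"
    using A.prime_power_fixed_point[OF p k _ ndvd] by auto
  then obtain g where g: "g \<in> carrier G" "R = H #> g"
    by (auto simp: RCOSETS_def)
  have "?\<phi> x R = R"
    by (rule R(2)) (simp add: generate.incl)
  then have "H #> g #> inv x = H #> g"
    using R(1) by (simp add: g(2))
  then have "H #> (g \<otimes> inv x) = H #> g"
    using g x subset by (simp add: coset_mult_assoc)
  moreover have "g \<otimes> inv x \<in> H #> (g \<otimes> inv x)"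
    using g x by (simp add: rcos_self H)
  ultimately have "g \<otimes> inv x \<in> H #> g"
    by simp
  then obtain h where h: "h \<in> H" "g \<otimes> inv x = h \<otimes> g"
    by (auto simp: r_coset_def)
  then have "g \<otimes> inv x \<otimes> inv g = h"
    using g x mem_carrier[OF h(1)] by (simp add: m_assoc)
  then have "inv h = g \<otimes> x \<otimes> inv g"
    using g x by (auto simp: inv_mult_group m_assoc)
  then have "g \<otimes> x \<otimes> inv g \<in> H"
    using m_inv_closed[OF h(1)] by simp
  then show thesis
    using that g by simp
qed

text \<open>Conjugate \<open>x\<close> and \<open>y\<close> into one Sylow p-subgroup
  \<open>P\<close>, as \<open>x'\<close> and \<open>y'\<close>. An orbit of \<open>P\<close> has
  p-power size below \<open>p\<^sup>2\<close> and contains an orbit of \<open>x'\<close> with more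
  than one point, so both have exactly \<open>p\<close> points and coincide. On such an orbit
  \<open>y'\<close> agrees with a power of \<open>x'\<close>, whose exponent may vary from orbit to
  orbit. Conjugating back by \<open>c\<close> restores \<open>x\<close> itself.\<close>

lemma (in group_action) conjugate_piecewise_power:
  assumes fin: "finite (carrier G)" "finite E" and p: "prime (p::nat)"
    and x: "x \<in> carrier G" "x [^]\<^bsub>G\<^esub> p = \<one>\<^bsub>G\<^esub>"
    and y: "y \<in> carrier G" "y [^]\<^bsub>G\<^esub> p = \<one>\<^bsub>G\<^esub>"
    and small: "\<And>w. w \<in> E \<Longrightarrow> card (orbit G \<phi> w) < p\<^sup>2"
    and free: "\<And>w. w \<in> E \<Longrightarrow> \<phi> x w \<noteq> w"
  obtains g where "g \<in> carrier G"
    "\<And>w. w \<in> E \<Longrightarrow> \<exists>i::nat. \<forall>n::nat.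
      \<phi> (g \<otimes> y \<otimes> inv g) (\<phi> (x [^] n) w) = \<phi> (x [^] (n + i)) w"
proof -
  interpret group G
    using group_hom group_hom.axioms(1) by auto
  have "order G > 0"
    using fin(1) by (simp add: order_gt_0_iff_finite)
  then obtain a m where am: "order G = p ^ a * m" "\<not> p dvd m"
    using multiplicity_decompose'[of "order G" p] p
    by (metis not_prime_unit bot_nat_0.not_eq_extremum)
  obtain P where P: "subgroup P G" "card P = p ^ a"
    using sylow_thm[OF p is_group am(1) fin(1)] by blast
  have "card (rcosets P) * p ^ a = p ^ a * m"
    using lagrange[OF P(1)] P(2) am(1) by simp
  then have ndvd: "\<not> p dvd card (rcosets P)"
    using am(2) p by (simp add: mult.commute)
  obtain c where c: "c \<in> carrier G" "c \<otimes> x \<otimes> inv c \<in> P"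
    using prime_order_conjugate_in_subgroup[OF fin(1) P(1) p ndvd x] by blast
  obtain d where d: "d \<in> carrier G" "d \<otimes> y \<otimes> inv d \<in> P"
    using prime_order_conjugate_in_subgroup[OF fin(1) P(1) p ndvd y] by blast
  define x' where "x' = c \<otimes> x \<otimes> inv c"
  define y' where "y' = d \<otimes> y \<otimes> inv d"
  have x'P: "x' \<in> P" and y'P: "y' \<in> P" and x'G: "x' \<in> carrier G" and y'G: "y' \<in> carrier G"
    using c d x y by (auto simp: x'_def y'_def)
  have pow: "x' [^] n = c \<otimes> x [^] n \<otimes> inv c" for n :: nat
  proof (induction n)
    case (Suc n)
    then show ?case
      using c(1) x(1) by (simp add: x'_def m_assoc inv_solve_left')
  qed (use c in auto)
  then have x'p: "x' [^] p = \<one>"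
    using c x by simp
  have comp: "\<phi> (g \<otimes> h) w = \<phi> g (\<phi> h w)" if "g \<in> carrier G" "h \<in> carrier G" "w \<in> E" for g h w
    using composition_rule that by blast
  have cl: "\<phi> g w \<in> E" if "g \<in> carrier G" "w \<in> E" for g w
    using element_image that by blast
  have inj: "u = v" if "\<phi> g u = \<phi> g v" "g \<in> carrier G" "u \<in> E" "v \<in> E" for g u v
    using inj_prop that by (meson inj_onD)
  have free': "\<phi> x' w \<noteq> w" if "w \<in> E" for w
  proof
    assume "\<phi> x' w = w"
    then have "\<phi> c (\<phi> x (\<phi> (inv c) w)) = \<phi> c (\<phi> (inv c) w)"
      using that c x cl by (simp add: x'_def m_assoc id_eq_one[symmetric] flip: comp)
    then have "\<phi> x (\<phi> (inv c) w) = \<phi> (inv c) w"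
      using inj c x that cl by (meson inv_closed)
    then show False
      using free that c cl by (meson inv_closed)
  qed
  interpret P: group_action "G\<lparr>carrier := P\<rparr>" E \<phi>
    by (rule induced_action[OF P(1)])
  have ordP: "order (G\<lparr>carrier := P\<rparr>) = p ^ a"
    using P(2) by (simp add: order_def)
  interpret X: group_action "G\<lparr>carrier := generate G {x'}\<rparr>" E \<phi>
    by (rule induced_action, rule generate_is_subgroup) (use x'G in simp)
  have key: "\<exists>i::nat. \<forall>n::nat. \<phi> y' (\<phi> (x' [^] n) w) = \<phi> (x' [^] (n + i)) w" if w: "w \<in> E" for w
  proof -
    let ?O = "orbit (G\<lparr>carrier := P\<rparr>) \<phi> w"
    let ?X = "orbit (G\<lparr>carrier := generate G {x'}\<rparr>) \<phi> w"
    have finO: "finite (orbit (G\<lparr>carrier := H\<rparr>) \<phi> v)" if "H \<subseteq> carrier G" "v \<in> E" for H v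
      using fin(2) by (rule rev_finite_subset) (use that cl in \<open>auto simp: orbit_def\<close>)
    have gP: "generate G {x'} \<subseteq> P"
      using generate_subgroup_incl[OF _ P(1)] x'P by simp
    have XO: "?X \<subseteq> ?O"
      using gP by (auto simp: orbit_def)
    have OG: "?O \<subseteq> orbit G \<phi> w"
      using subgroup.subset[OF P(1)] by (auto simp: orbit_def)
    have "card ?O \<le> card (orbit G \<phi> w)"
      by (rule card_mono[OF _ OG]) (use finO[of "carrier G"] w in simp)
    with small[OF w] have cO: "card ?O < p\<^sup>2"
      by simp
    have "{w, \<phi> x' w} \<subseteq> ?X"
      using X.orbit_refl[OF w] generate.incl[of x' "{x'}" G] by (auto simp: orbit_def)
    then have "card {w, \<phi> x' w} \<le> card ?X"
      by (rule card_mono[rotated]) (use finO[of "generate G {x'}"] gP subgroup.subset[OF P(1)] w in auto)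
    then have cX: "card ?X > 1"
      using free'[OF w] by auto
    obtain j where j: "card ?O = p ^ j"
      using P.prime_power_orbit[OF p ordP w] by blast
    obtain k where k: "card ?X = p ^ k"
      using X.prime_power_orbit[OF p _ w] order_generate_prime(1)[OF p x'G x'p] by blast
    \<comment> \<open>From 1 <= k <= j < 2 both orbits have size \<open>p\<close>.\<close>
    have "j < 2"
      using cO j p by (metis power_less_imp_less_exp prime_gt_1_nat)
    moreover have "k \<noteq> 0"
      using cX by (intro notI) (simp add: k)
    moreover have "k \<le> j"
      using card_mono[OF _ XO] finO[OF subgroup.subset[OF P(1)] w] j k p
      by (metis power_le_imp_le_exp prime_gt_1_nat)
    ultimately have jk: "j = 1" "k = 1"
      by auto
    then have XO: "?X = ?O"
      using card_subset_eq[OF _ XO] finO[OF subgroup.subset[OF P(1)] w] j k by simp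
    have "\<phi> y' w \<in> ?X"
      unfolding XO using y'P by (auto simp: orbit_def)
    then obtain i :: nat where i: "\<phi> y' w = \<phi> (x' [^] i) w"
      using order_generate_prime(2)[OF p x'G x'p] by (auto simp: orbit_def)
    let ?S = "stabilizer (G\<lparr>carrier := P\<rparr>) \<phi> w"
    \<comment> \<open>The exponent \<open>i\<close> is read off at the single point
      \<open>w\<close>; \<open>?z\<close> measures how far \<open>y'\<close> is from
      \<open>x' [^] i\<close>, and it fixes \<open>w\<close>. It remains to see that it fixes the
      whole orbit.\<close>
    let ?z = "inv (x' [^] i) \<otimes> y'"
    have S: "subgroup ?S (G\<lparr>carrier := P\<rparr>)"
      by (rule P.stabilizer_subgroup[OF w])
    have SP: "?S \<subseteq> P"
      by (auto simp: stabilizer_def)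
    have xiP: "x' [^] i \<in> P"
      by (induction i) (use P(1) x'P in \<open>auto simp: subgroup.m_closed subgroup.one_closed\<close>)
    have zP: "?z \<in> P"
      using xiP y'P P(1) by (simp add: subgroup.m_closed subgroup.m_inv_closed)
    have "\<phi> ?z w = \<phi> (inv (x' [^] i)) (\<phi> (x' [^] i) w)"
      using x'G y'G w by (simp add: comp i)
    also have "\<dots> = w"
      using x'G w by (simp add: id_eq_one[symmetric] flip: comp)
    finally have zS: "?z \<in> ?S"
      using zP by (simp add: stabilizer_def)
    interpret S: group_action "G\<lparr>carrier := ?S\<rparr>" E \<phi>
      using P.induced_action[OF S] by simp
    have "card ?S dvd p ^ a"
      using P.orbit_stabilizer_theorem[OF w] ordP by (metis dvd_triv_right)
    then obtain l where l: "order (G\<lparr>carrier := ?S\<rparr>) = p ^ l"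
      using p by (auto simp: order_def divides_primepow_nat)
    \<comment> \<open>The stabilizer of \<open>w\<close> in \<open>P\<close> is a p-group. Its
      orbits on the other p - 1 points of \<open>?O\<close> have p-power size below
      \<open>p\<close>, hence size 1.\<close>
    have fixO: "\<phi> ?z v = v" if v: "v \<in> ?O" for v
    proof (cases "v = w")
      case True
      then show ?thesis
        using zS by (simp add: stabilizer_def)
    next
      case False
      let ?V = "orbit (G\<lparr>carrier := ?S\<rparr>) \<phi> v"
      have vE: "v \<in> E"
        using v w cl subgroup.subset[OF P(1)] by (auto simp: orbit_def)
      have "?V \<subseteq> orbit (G\<lparr>carrier := P\<rparr>) \<phi> v"
        using SP by (auto simp: orbit_def)
      also have "\<dots> \<subseteq> ?O"
      proof
        fix u assume u: "u \<in> orbit (G\<lparr>carrier := P\<rparr>) \<phi> v"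
        then have "u \<in> E"
          using vE cl subgroup.subset[OF P(1)] by (auto simp: orbit_def)
        then show "u \<in> ?O"
          using P.orbit_trans[OF w vE _ v u] by blast
      qed
      finally have VO: "?V \<subseteq> ?O" .
      have "w \<notin> ?V"
      proof
        assume "w \<in> ?V"
        then obtain s where s: "s \<in> ?S" "\<phi> s v = w"
          by (auto simp: orbit_def)
        then have "\<phi> s v = \<phi> s w" "s \<in> carrier G"
          using subgroup.subset[OF P(1)] by (auto simp: stabilizer_def)
        then show False
          using inj vE w False by blast
      qed
      moreover have "w \<in> ?O"
        by (rule P.orbit_refl[OF w])
      ultimately have "?V \<subset> ?O"
        using VO by blast
      then have "card ?V < p"
        using psubset_card_mono[OF finO[OF subgroup.subset[OF P(1)] w]] j jk by simp
      moreover obtain q where "card ?V = p ^ q"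
        using S.prime_power_orbit[OF p l vE] by blast
      ultimately have "card ?V = 1"
        by (cases q) (use p prime_gt_1_nat in \<open>auto simp: Suc_le_eq\<close>)
      then have "?V = {v}"
        using S.orbit_refl[OF vE] by (metis card_1_singletonE singletonD)
      then show ?thesis
        using zS by (auto simp: orbit_def)
    qed
    have "\<phi> y' (\<phi> (x' [^] n) w) = \<phi> (x' [^] (n + i)) w" for n :: nat
    proof -
      let ?v = "\<phi> (x' [^] n) w"
      have vE: "?v \<in> E"
        using cl x'G w by simp
      have "?v \<in> ?X"
        using order_generate_prime(2)[OF p x'G x'p] by (auto simp: orbit_def)
      then have "\<phi> ?z ?v = ?v"
        using fixO XO by blast
      then have "\<phi> (x' [^] i) (\<phi> ?z ?v) = \<phi> (x' [^] i) ?v"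
        by simp
      moreover have "\<phi> (x' [^] i) (\<phi> ?z ?v) = \<phi> y' ?v"
        using x'G y'G vE by (simp add: inv_solve_left' flip: comp m_assoc)
      moreover have "\<phi> (x' [^] i) ?v = \<phi> (x' [^] (n + i)) w"
        using x'G w by (simp add: add.commute nat_pow_mult flip: comp)
      ultimately show ?thesis
        by simp
    qed
    then show ?thesis
      by blast
  qed
  show thesis
  proof (rule that)
    \<comment> \<open>Conjugation by \<open>inv c\<close> takes \<open>x'\<close> to
      \<open>x\<close>, and it takes \<open>y'\<close> to the conjugate of \<open>y\<close> by
      \<open>inv c \<otimes> d\<close>. So the claim at \<open>w\<close> is \<open>key\<close> at
      the point \<open>\<phi> c w\<close>.\<close>
    show gc: "inv c \<otimes> d \<in> carrier G"
      using c d by simp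
    fix w assume w: "w \<in> E"
    obtain i :: nat where i: "\<And>n::nat. \<phi> y' (\<phi> (x' [^] n) (\<phi> c w)) = \<phi> (x' [^] (n + i)) (\<phi> c w)"
      using key[OF cl[OF c(1) w]] by blast
    have "\<phi> (inv c \<otimes> d \<otimes> y \<otimes> inv (inv c \<otimes> d)) (\<phi> (x [^] n) w) = \<phi> (x [^] (n + i)) w" for n :: nat
    proof -
      have "inv c \<otimes> d \<otimes> y \<otimes> inv (inv c \<otimes> d) \<otimes> x [^] n = inv c \<otimes> (y' \<otimes> (x' [^] n \<otimes> c))"
        unfolding pow y'_def using c(1) d(1) x(1) y(1)
        by (simp add: m_assoc inv_mult_group)
      then have "\<phi> (inv c \<otimes> d \<otimes> y \<otimes> inv (inv c \<otimes> d)) (\<phi> (x [^] n) w)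
          = \<phi> (inv c) (\<phi> y' (\<phi> (x' [^] n) (\<phi> c w)))"
        using c(1) d(1) x(1) y(1) w x'G y'G cl by (simp flip: comp)
      also have "\<dots> = \<phi> (inv c \<otimes> (x' [^] (n + i) \<otimes> c)) w"
        using c(1) w x'G by (simp add: i comp cl)
      also have "inv c \<otimes> (x' [^] (n + i) \<otimes> c) = x [^] (n + i)"
        unfolding pow using c(1) x(1) by (simp add: m_assoc inv_solve_left')
      finally show ?thesis .
    qed
    then show "\<exists>i::nat. \<forall>n::nat. \<phi> (inv c \<otimes> d \<otimes> y \<otimes> inv (inv c \<otimes> d)) (\<phi> (x [^] n) w) = \<phi> (x [^] (n + i)) w"
      by blast
  qed
qed

section \<open>Piecewise affine maps modulo \<open>2 p\<close>\<close>

lemma even_cong_double: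
  fixes a b p :: int
  shows "[2 * a = 2 * b] (mod 2 * p) \<longleftrightarrow> [a = b] (mod p)"
  unfolding cong_iff_dvd_diff right_diff_distrib[symmetric] dvd_mult_cancel_left by simp

lemma cong_double_odd:
  fixes a b p :: int
  assumes "odd p" "[a = b] (mod p)" "even (a - b)"
  shows "[a = b] (mod 2 * p)"
  unfolding cong_iff_dvd_diff
  by (rule divides_mult) (use assms in \<open>simp_all add: cong_iff_dvd_diff\<close>)

lemma prime_cong_solve:
  fixes m l p :: int
  assumes "prime p" "\<not> p dvd m"
  obtains j where "[m * j = l] (mod p)"
proof -
  have "coprime m p"
    using assms by (metis coprime_commute prime_imp_coprime)
  then obtain i where "[m * i = 1] (mod p)"
    using cong_solve_coprime_int by blast
  then have "[m * i * l = 1 * l] (mod p)"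
    by (rule cong_mult) simp
  then show thesis
    using that[of "i * l"] by (simp add: mult.assoc)
qed

text \<open>Advancing the argument by \<open>2 * i\<close> adds 2 to the value, so advancing it by
  \<open>2 * k * i\<close> adds \<open>2 * k\<close>. If \<open>p\<close> divided \<open>i\<close>,
  periodicity would give 2 = 0 modulo \<open>2 * p\<close>. Hence \<open>i\<close> has an inverse
  \<open>m\<close> modulo \<open>p\<close>, every \<open>j\<close> is congruent to
  \<open>k * i\<close> with \<open>k = m * j\<close>, and \<open>m\<close> is the slope.\<close>

lemma affine_on_parity_class:
  fixes h :: "int \<Rightarrow> int" and p e :: int and i :: nat
  assumes p: "prime p" "odd p"
    and h: "\<And>x y. [x = y] (mod 2 * p) \<Longrightarrow> h x = h y"
    and shift: "\<And>n::nat. [h (e + 2 * (int n + int i)) = h (e + 2 * int n) + 2] (mod 2 * p)"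
  shows "\<exists>m. \<forall>j. [h (e + 2 * j) = h e + 2 * (m * j)] (mod 2 * p)"
proof -
  have rep: "[h (e + 2 * int (k * i)) = h e + 2 * int k] (mod 2 * p)" for k :: nat
  proof (induction k)
    case (Suc k)
    have "[h (e + 2 * int (Suc k * i)) = h (e + 2 * int (k * i)) + 2] (mod 2 * p)"
      using shift[of "k * i"] by (simp add: algebra_simps)
    also have "[h (e + 2 * int (k * i)) + 2 = h e + 2 * int k + 2] (mod 2 * p)"
      by (rule cong_add[OF Suc.IH]) simp
    finally show ?case
      by (simp add: algebra_simps)
  qed simp
  have "\<not> p dvd int i"
  proof
    assume "p dvd int i"
    then have "h (e + 2 * int (1 * i)) = h e"
      by (intro h) (simp add: cong_iff_dvd_diff)
    with rep[of 1] have "[2 * 0 = 2 * 1] (mod 2 * p)"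
      by (simp add: cong_iff_dvd_diff)
    then have "is_unit p"
      unfolding even_cong_double by (simp add: cong_iff_dvd_diff)
    then show False
      using p not_prime_unit by blast
  qed
  then obtain m where m: "[int i * m = 1] (mod p)"
    using prime_cong_solve[OF p(1)] by blast
  have "[h (e + 2 * j) = h e + 2 * (m * j)] (mod 2 * p)" for j
  proof -
    \<comment> \<open>\<open>rep\<close> is about natural multiples, so the residue of
      \<open>m * j\<close> in the range from 0 to p - 1 is used.\<close>
    define k where "k = nat ((m * j) mod p)"
    have k: "[int k = m * j] (mod p)"
      using p prime_gt_0_int[of p] by (simp add: k_def cong_def)
    then have "[int k * int i = m * j * int i] (mod p)"
      by (rule cong_mult) simp
    also have "[m * j * int i = j] (mod p)"
      using cong_mult[OF m cong_refl[of j]] by (simp add: ac_simps)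
    finally have "[2 * int (k * i) = 2 * j] (mod 2 * p)"
      by (simp add: even_cong_double)
    then have "h (e + 2 * j) = h (e + 2 * int (k * i))"
      by (intro h cong_add) (simp_all add: cong_sym)
    also have "[\<dots> = h e + 2 * int k] (mod 2 * p)"
      by (rule rep)
    also have "[h e + 2 * int k = h e + 2 * (m * j)] (mod 2 * p)"
      using k by (intro cong_add) (simp_all add: even_cong_double)
    finally show ?thesis .
  qed
  then show ?thesis
    by blast
qed

text \<open>With slope 0 modulo \<open>p\<close>, the arguments \<open>e\<close> and
  \<open>e + 2\<close> would have the same value.\<close>

lemma affine_on_parity_class_nonzero:
  fixes h :: "int \<Rightarrow> int" and p e m :: int
  assumes p: "prime p"
    and inj: "\<And>x y. [h x = h y] (mod 2 * p) \<Longrightarrow> [x = y] (mod 2 * p)"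
    and h: "\<And>j. [h (e + 2 * j) = h e + 2 * (m * j)] (mod 2 * p)"
  shows "\<not> p dvd m"
proof
  assume "p dvd m"
  then have "[2 * (m * 1) = 2 * 0] (mod 2 * p)"
    unfolding even_cong_double by (simp add: cong_0_iff)
  then have "[h e + 2 * (m * 1) = h e + 2 * 0] (mod 2 * p)"
    by (intro cong_add) simp_all
  then have "[h (e + 2 * 1) = h e] (mod 2 * p)"
    using h[of 1] by (simp add: cong_def)
  then have "[2 * 1 = 2 * 0] (mod 2 * p)"
    using inj by (fastforce simp: cong_iff_dvd_diff)
  then have "is_unit p"
    unfolding even_cong_double by (simp add: cong_iff_dvd_diff)
  then show False
    using p not_prime_unit by blast
qed

text \<open>The slope is invertible modulo \<open>p\<close>, so the even arguments already take
  every value, modulo \<open>2 * p\<close>, of the parity of \<open>h 0\<close>. By injectivity none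
  of these is left for \<open>h 1\<close>.\<close>

lemma affine_on_parity_classes_parity:
  fixes h :: "int \<Rightarrow> int" and p m :: int
  assumes p: "prime p"
    and inj: "\<And>x y. [h x = h y] (mod 2 * p) \<Longrightarrow> [x = y] (mod 2 * p)"
    and h: "\<And>j. [h (2 * j) = h 0 + 2 * (m * j)] (mod 2 * p)"
  shows "odd (h 1 - h 0)"
proof
  assume "even (h 1 - h 0)"
  then obtain d where d: "h 1 - h 0 = 2 * d"
    by blast
  have "\<not> p dvd m"
    using affine_on_parity_class_nonzero[of p h 0 m] assms by simp
  then obtain j where j: "[m * j = d] (mod p)"
    using prime_cong_solve[OF p] by blast
  have "[h (2 * j) = h 0 + 2 * (m * j)] (mod 2 * p)"
    by (rule h)
  also have "[h 0 + 2 * (m * j) = h 0 + 2 * d] (mod 2 * p)"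
    using j by (intro cong_add) (simp_all add: even_cong_double)
  finally have "[2 * j = 1] (mod 2 * p)"
    using inj d by (simp add: algebra_simps)
  then have "even (2 * j - 1)"
    by (metis cong_iff_dvd_diff dvd_mult_left)
  then show False
    by simp
qed

text \<open>Since \<open>d\<close> is invertible modulo \<open>p\<close>, repeated shifts by
  \<open>2 * d\<close> reach the whole parity class of \<open>a\<close>.\<close>

lemma constant_on_parity_class:
  fixes T :: "int \<Rightarrow> bool" and p a d :: int
  assumes p: "prime p" and T: "\<And>x y. [x = y] (mod 2 * p) \<Longrightarrow> T x = T y"
    and d: "\<not> p dvd d" "\<And>l. T (a + 2 * l + 2 * d) = T (a + 2 * l)"
  shows "T (a + 2 * l) = T a"
proof -
  have rep: "T (a + 2 * (d * int i)) = T a" for i :: nat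
  proof (induction i)
    case (Suc i)
    then show ?case
      using d(2)[of "d * int i"] by (simp add: algebra_simps)
  qed simp
  obtain j where j: "[d * j = l] (mod p)"
    using prime_cong_solve[OF p d(1)] by blast
  have "[d * int (nat (j mod p)) = d * j] (mod p)"
    using prime_gt_0_int[OF p] by (intro cong_mult) (simp_all add: cong_def)
  then have "[2 * (d * int (nat (j mod p))) = 2 * l] (mod 2 * p)"
    unfolding even_cong_double using j by (rule cong_trans)
  then have "T (a + 2 * l) = T (a + 2 * (d * int (nat (j mod p))))"
    by (intro T cong_add) (simp_all add: cong_sym)
  then show ?thesis
    by (simp only: rep)
qed

text \<open>Even and odd differences are treated separately. If \<open>T\<close> is constant on the
  parity class met by one kind of difference, an affine map only has to hit that class, and the
  other kind determines the map. If \<open>T\<close> is constant on neither class, all slopes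
  involved agree modulo \<open>p\<close>, and comparing the values of \<open>S\<close> read off at x
  = 0 and at x = 1 forces the intercepts to fit together.\<close>

lemma piecewise_affine_imp_affine:
  fixes S T :: "int \<Rightarrow> bool" and h k :: "int \<Rightarrow> int" and p :: int
  assumes p: "prime p" "odd p"
    and T: "\<And>x y. [x = y] (mod 2 * p) \<Longrightarrow> T x = T y"
    and iso: "\<And>x y. S (y - x) \<longleftrightarrow> T (k y - h x)"
    and inj: "\<And>x y. [h x = h y] (mod 2 * p) \<Longrightarrow> [x = y] (mod 2 * p)"
      "\<And>x y. [k x = k y] (mod 2 * p) \<Longrightarrow> [x = y] (mod 2 * p)"
    and h: "\<And>e. e \<in> {0, 1} \<Longrightarrow> \<exists>m. \<forall>j. [h (e + 2 * j) = h e + 2 * (m * j)] (mod 2 * p)"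
    and k: "\<And>e. e \<in> {0, 1} \<Longrightarrow> \<exists>m. \<forall>j. [k (e + 2 * j) = k e + 2 * (m * j)] (mod 2 * p)"
  obtains m t where "coprime m (2 * p)" "\<And>z. S z \<longleftrightarrow> T (m * z + t)"
proof -
  obtain m0 where m0: "\<And>j. [h (0 + 2 * j) = h 0 + 2 * (m0 * j)] (mod 2 * p)"
    using h by blast
  obtain n where n: "\<And>e j. e \<in> {0, 1} \<Longrightarrow> [k (e + 2 * j) = k e + 2 * (n e * j)] (mod 2 * p)"
    using k by metis
  have n_nz: "\<not> p dvd n e" if "e \<in> {0, 1}" for e
    by (rule affine_on_parity_class_nonzero[of p k e]) (use p(1) inj(2) n that in blast)+
  have odd_h: "odd (h 1 - h 0)"
    by (rule affine_on_parity_classes_parity[OF p(1), of h m0, OF inj(1)]) (use m0 in simp_all)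
  have odd_k: "odd (k 1 - k 0)"
    by (rule affine_on_parity_classes_parity[OF p(1), of k "n 0", OF inj(2)]) (use n[of 0] in simp_all)
  have S_T: "S (e - x + 2 * j) \<longleftrightarrow> T (k e - h x + 2 * (n e * j))" if "e \<in> {0, 1}" for e x j
  proof -
    have "S (e - x + 2 * j) \<longleftrightarrow> T (k (e + 2 * j) - h x)"
      using iso[of "e + 2 * j" x] by (simp add: algebra_simps)
    also have "\<dots> \<longleftrightarrow> T (k e + 2 * (n e * j) - h x)"
      by (intro T cong_diff n that cong_refl)
    finally show ?thesis
      by (simp add: algebra_simps)
  qed
  \<comment> \<open>By \<open>odd_h\<close> and \<open>odd_k\<close>, \<open>a\<close> and
    \<open>b\<close> have one parity and \<open>c\<close> and \<open>d\<close> the other. The first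
    pair goes with even differences y - x, the second with odd ones.\<close>
  define a b c d where "a = k 0 - h 0" and "b = k 1 - h 1" and "c = k 1 - h 0" and "d = k 0 - h 1"
  have slope: "[n e = m0] (mod p)"
    \<comment> \<open>Replacing x = 0 and y = e by 2 l and e + 2 l keeps y - x, but shifts the
      argument of \<open>T\<close> by 2 (n e - m0) l. If the slopes differ, these shifts exhaust the
      parity class.\<close>
    if e: "e \<in> {0, 1}" and nc: "\<not> (\<forall>l. T (k e - h 0 + 2 * l) = T (k e - h 0))" for e
  proof (rule ccontr)
    assume "\<not> [n e = m0] (mod p)"
    then have nd: "\<not> p dvd n e - m0"
      by (simp add: cong_iff_dvd_diff)
    have const: "T (k e - h 0 + 2 * ((n e - m0) * l)) = S e" for l
    proof -
      have "S e = T (k (e + 2 * l) - h (0 + 2 * l))"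
        using iso[of "e + 2 * l" "0 + 2 * l"] by simp
      also have "\<dots> = T (k e + 2 * (n e * l) - (h 0 + 2 * (m0 * l)))"
        by (intro T cong_diff n m0 e)
      finally show ?thesis
        by (simp add: algebra_simps)
    qed
    have "T (k e - h 0 + 2 * l) = S e" for l
    proof -
      obtain j where "[(n e - m0) * j = l] (mod p)"
        using prime_cong_solve[OF p(1) nd] by blast
      then have "T (k e - h 0 + 2 * l) = T (k e - h 0 + 2 * ((n e - m0) * j))"
        by (intro T cong_add) (simp_all add: even_cong_double cong_sym)
      then show ?thesis
        by (simp add: const)
    qed
    then show False
      using nc by (metis add_0_right mult_zero_right)
  qed
  \<comment> \<open>Slopes matter only modulo \<open>p\<close>, since they multiply even numbers;
    adding \<open>p\<close> makes one odd, and thus a unit modulo \<open>2 * p\<close>.\<close>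
  have odd_rep: "\<exists>m. odd m \<and> coprime m (2 * p) \<and> [m = n e] (mod p)" if "e \<in> {0, 1}" for e
  proof -
    define m where "m = (if odd (n e) then n e else n e + p)"
    have m: "odd m" "[m = n e] (mod p)"
      using p by (auto simp: m_def cong_iff_dvd_diff)
    have "\<not> p dvd m"
      using n_nz[OF that] m(2) by (metis cong_dvd_iff cong_sym)
    then have "coprime m p"
      using p by (metis coprime_commute prime_imp_coprime)
    then show ?thesis
      using m by (intro exI[of _ m]) simp
  qed
  have even_value: "S (2 * j) \<longleftrightarrow> T (a + 2 * (n 0 * j))" for j
    using S_T[of 0 0 j] by (simp add: a_def)
  have odd_value: "S (1 + 2 * j) \<longleftrightarrow> T (c + 2 * (n 1 * j))" for j
    using S_T[of 1 0 j] by (simp add: c_def)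
  have rescale: "T (z + 2 * (m * j)) = T (z + 2 * (n' * j))" if "[m = n'] (mod p)" for z m n' j
    using that by (intro T cong_add cong_refl) (simp add: even_cong_double cong_mult)
  show thesis
  proof (cases "\<forall>l. T (a + 2 * l) = T a")
    case True
    obtain m where m: "odd m" "coprime m (2 * p)" "[m = n 1] (mod p)"
      using odd_rep[of 1] by auto
    \<comment> \<open>The intercept sends 1 to \<open>c\<close>, which settles odd \<open>z\<close>.
      For even \<open>z\<close> only the parity of the image counts.\<close>
    have "S z \<longleftrightarrow> T (m * z + (c - m))" for z
    proof (cases "even z")
      case True
      then obtain j where j: "z = 2 * j" ..
      have "even (m * z + (c - m) - a)"
        using j m(1) odd_k by (simp add: a_def c_def)
      then obtain l where "m * z + (c - m) - a = 2 * l" ..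
      then have "m * z + (c - m) = a + 2 * l"
        by simp
      then show ?thesis
        using \<open>\<forall>l. T (a + 2 * l) = T a\<close> even_value j by simp
    next
      case False
      then obtain j where j: "z = 2 * j + 1" by (rule oddE)
      have "m * z + (c - m) = c + 2 * (m * j)"
        using j by (simp add: algebra_simps)
      then show ?thesis
        using odd_value[of j] rescale[OF m(3), of c j] j by (simp only: add.commute)
    qed
    then show ?thesis
      by (rule that[OF m(2)])
  next
    case ncE: False
    obtain m where m: "odd m" "coprime m (2 * p)" "[m = n 0] (mod p)"
      using odd_rep[of 0] by auto
    \<comment> \<open>The intercept sends 0 to \<open>a\<close>, which settles even
      \<open>z\<close>; odd \<open>z\<close> is trivial if \<open>T\<close> is constant on the class
      of \<open>c\<close>.\<close>
    have "S z \<longleftrightarrow> T (m * z + a)" for z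
    proof (cases "even z")
      case True
      then obtain j where j: "z = 2 * j" ..
      have "m * z + a = a + 2 * (m * j)"
        using j by (simp add: algebra_simps)
      then show ?thesis
        using even_value[of j] rescale[OF m(3), of a j] j by (simp only:)
    next
      case False
      then obtain j where j: "z = 2 * j + 1" by (rule oddE)
      have Sz: "S z \<longleftrightarrow> T (c + 2 * (n 1 * j))"
        using odd_value[of j] j by (simp add: add.commute)
      have ev: "even (m * z + a - c)"
        using j m(1) odd_k by (simp add: a_def c_def)
      show ?thesis
      proof (cases "\<forall>l. T (c + 2 * l) = T c")
        case True
        obtain l where "m * z + a - c = 2 * l"
          using ev ..
        then have "m * z + a = c + 2 * l"
          by simp
        then show ?thesis
          using True Sz by simp
      next
        case ncO: False
        have n0: "[n 0 = m0] (mod p)" and n1: "[n 1 = m0] (mod p)"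
          using slope[of 0] slope[of 1] ncE ncO by (simp_all add: a_def c_def)
        have mn0: "[n 0 = m] (mod p)" and mn1: "[n 1 = m] (mod p)"
          using m(3) n0 n1 by (simp_all add: cong_def)
        have nd: "\<not> p dvd m"
          using n_nz[of 0] mn0 by (simp add: cong_dvd_iff)
        \<comment> \<open>A nonzero even shift between \<open>u\<close> and \<open>v\<close> would
          be a period of \<open>T\<close> on the class of \<open>v\<close>, making \<open>T\<close>
          constant there by \<open>constant_on_parity_class\<close>.\<close>
        have period: "[u = v] (mod 2 * p)"
          if uv: "\<And>j. T (u + 2 * (m * j)) = T (v + 2 * (m * j))"
            and par: "even (u - v)" and nc: "\<not> (\<forall>l. T (v + 2 * l) = T v)" for u v
        proof (rule ccontr)
          assume ncong: "\<not> [u = v] (mod 2 * p)"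
          obtain q where q: "u - v = 2 * q"
            using par ..
          then have "\<not> p dvd q"
            using ncong by (simp add: cong_iff_dvd_diff)
          moreover have "T (v + 2 * l + 2 * q) = T (v + 2 * l)" for l
          proof -
            obtain i where i: "[m * i = l] (mod p)"
              using prime_cong_solve[OF p(1) nd] by blast
            have "T (v + 2 * l + 2 * q) = T (u + 2 * l)"
              using q by (simp add: algebra_simps)
            also have "\<dots> = T (u + 2 * (m * i))"
              using i by (intro T cong_add) (simp_all add: even_cong_double cong_sym)
            also have "\<dots> = T (v + 2 * (m * i))"
              by (rule uv)
            also have "\<dots> = T (v + 2 * l)"
              using i by (intro T cong_add) (simp_all add: even_cong_double)
            finally show ?thesis .
          qed
          ultimately have "T (v + 2 * l) = T v" for l
            using constant_on_parity_class[of p T q v l] p(1) T by blast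
          then show False
            using nc by blast
        qed
        have "[b = a] (mod 2 * p)"
        proof (rule period)
          fix i
          show "T (b + 2 * (m * i)) = T (a + 2 * (m * i))"
            using S_T[of 1 1 i] even_value[of i] rescale[OF mn0, of a i] rescale[OF mn1, of b i]
              by (simp add: b_def)
        qed (use odd_h odd_k ncE in \<open>auto simp: a_def b_def\<close>)
        moreover have "[d + 2 * m = c] (mod 2 * p)"
        proof (rule period)
          fix i
          have "S (1 + 2 * i) = T (d + 2 * (n 0 * (i + 1)))"
            using S_T[of 0 1 "i + 1"] by (simp add: d_def algebra_simps)
          also have "\<dots> = T (d + 2 * (m * (i + 1)))"
            by (rule rescale[OF mn0])
          finally show "T (d + 2 * m + 2 * (m * i)) = T (c + 2 * (m * i))"
            using odd_value[of i] rescale[OF mn1, of c i] by (simp add: algebra_simps)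
        qed (use odd_h odd_k ncO in \<open>auto simp: c_def d_def\<close>)
        \<comment> \<open>In the difference of the two congruences \<open>h 0\<close> and
          \<open>h 1\<close> cancel, leaving twice the wanted relation \<open>c = m + a\<close>.
          Halving gives it modulo \<open>p\<close>, and parity lifts it to
          \<open>2 * p\<close>.\<close>
        ultimately have "2 * p dvd (b - a) - (d + 2 * m - c)"
          by (meson cong_iff_dvd_diff dvd_diff)
        moreover have "(b - a) - (d + 2 * m - c) = 2 * (c - (m + a))"
          by (simp add: a_def b_def c_def d_def)
        ultimately have "2 * p dvd 2 * (c - (m + a))"
          by (simp only:)
        then have "[c = m + a] (mod p)"
          unfolding cong_iff_dvd_diff dvd_mult_cancel_left by simp
        then have "[c = m + a] (mod 2 * p)"
          by (rule cong_double_odd[OF p(2)]) (use m(1) odd_k in \<open>simp add: a_def c_def\<close>)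
        then have "T (c + 2 * (m * j)) = T (m + a + 2 * (m * j))"
          by (intro T cong_add cong_refl)
        then show ?thesis
          using Sz rescale[OF mn1, of c j] j by (simp add: algebra_simps)
      qed
    qed
    then show ?thesis
      by (rule that[OF m(2)])
  qed
qed

section \<open>Isomorphisms of bipartite and coloured graphs\<close>

text \<open>Induction on the number of vertices sent to the wrong side. If \<open>w\<close> is one,
  then every vertex mapped into the component of \<open>f w\<close> is wrong as well. Composing with
  a side-reversing automorphism on this component alone repairs all of them and changes nothing
  else.\<close>

lemma side_preserving_isomorphism:
  fixes V :: "'v set" and E F :: "'v \<Rightarrow> 'v \<Rightarrow> bool" and side :: "'v \<Rightarrow> bool"
  assumes fin: "finite V"
    and E: "\<And>u v. E u v \<Longrightarrow> side u \<noteq> side v"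
    and F: "\<And>u v. F u v \<Longrightarrow> u \<in> V \<and> v \<in> V" "\<And>u v. F u v \<Longrightarrow> side u \<noteq> side v"
      "\<And>u v. F u v \<Longrightarrow> F v u" "\<And>v. v \<in> V \<Longrightarrow> \<exists>u. F v u"
    and swap: "\<And>u v. F u v \<Longrightarrow> \<exists>t. bij_betw t V V \<and> (\<forall>x\<in>V. \<forall>y\<in>V. F x y \<longleftrightarrow> F (t x) (t y)) \<and>
      (\<forall>x\<in>V. side (t x) \<noteq> side x) \<and> t u = v \<and> t v = u"
    and f: "bij_betw f V V" "\<forall>u\<in>V. \<forall>v\<in>V. E u v \<longleftrightarrow> F (f u) (f v)"
  shows "\<exists>f. bij_betw f V V \<and> (\<forall>u\<in>V. \<forall>v\<in>V. E u v \<longleftrightarrow> F (f u) (f v)) \<and> (\<forall>v\<in>V. side (f v) = side v)"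
  using f
proof (induction "card {v \<in> V. side (f v) \<noteq> side v}" arbitrary: f rule: less_induct)
  case less
  note f = less.prems
  show ?case
  proof (cases "\<exists>w\<in>V. side (f w) \<noteq> side w")
    case False
    then show ?thesis
      using f by blast
  next
    case True
    then obtain w where w: "w \<in> V" "side (f w) \<noteq> side w"
      by blast
    have fV: "f x \<in> V" if "x \<in> V" for x
      using f(1) that by (auto simp: bij_betw_def)
    obtain v where v: "F (f w) v"
      using F(4) fV w(1) by blast
    obtain t where t: "bij_betw t V V" "\<And>x y. x \<in> V \<Longrightarrow> y \<in> V \<Longrightarrow> F x y \<longleftrightarrow> F (t x) (t y)"
      "\<And>x. x \<in> V \<Longrightarrow> side (t x) \<noteq> side x" "t (f w) = v" "t v = f w"
      using swap[OF v] by blast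
    \<comment> \<open>The connected component of \<open>f w\<close>. Since \<open>t\<close> swaps
      \<open>f w\<close> with a neighbour, it maps \<open>D\<close> into itself.\<close>
    define D where "D = {x. F\<^sup>*\<^sup>* (f w) x}"
    have DV: "D \<subseteq> V"
    proof
      fix x assume "x \<in> D"
      then have "F\<^sup>*\<^sup>* (f w) x"
        by (simp add: D_def)
      then show "x \<in> V"
        by (induction rule: rtranclp_induct) (use fV w F(1) in auto)
    qed
    have D_step: "x \<in> D \<longleftrightarrow> y \<in> D" if "F x y" for x y
      using that F(3) unfolding D_def by (meson mem_Collect_eq rtranclp.rtrancl_into_rtrancl)
    have tD: "t x \<in> D" if "x \<in> D" for x
    proof -
      have "F\<^sup>*\<^sup>* (f w) x"
        using that by (simp add: D_def)
      then show ?thesis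
      proof (induction rule: rtranclp_induct)
        case base
        show ?case
          using v t(4) by (auto simp: D_def)
      next
        case (step y z)
        then show ?case
          using D_step t(2) F(1) by blast
      qed
    qed
    \<comment> \<open>Sides alternate along edges in both graphs, so being on the wrong side
      propagates from \<open>f w\<close> through the component.\<close>
    have flipped: "\<forall>z\<in>V. f z = x \<longrightarrow> side (f z) \<noteq> side z" if "x \<in> D" for x
    proof -
      have "F\<^sup>*\<^sup>* (f w) x"
        using that by (simp add: D_def)
      then show ?thesis
      proof (induction rule: rtranclp_induct)
        case base
        show ?case
          using w f(1) by (metis bij_betw_inv_into_left)
      next
        case (step y z)
        have "y \<in> V"
          using step.hyps F(1) by blast
        then obtain y' where y': "y' \<in> V" "f y' = y"
          using f(1) by (metis bij_betw_def imageE)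
        show ?case
        proof (intro ballI impI)
          fix z' assume z': "z' \<in> V" "f z' = z"
          then have "E y' z'"
            using f(2) y' step.hyps by blast
          then show "side (f z') \<noteq> side z'"
            using E[of y' z'] F(2)[OF step.hyps(2)] step.IH y' z' by auto
        qed
      qed
    qed
    \<comment> \<open>No edge joins \<open>D\<close> to its complement, so applying \<open>t\<close>
      inside \<open>D\<close> only is still an automorphism.\<close>
    define \<psi> where "\<psi> x = (if x \<in> D then t x else x)" for x
    have \<psi>V: "\<psi> x \<in> V" if "x \<in> V" for x
      using that t(1) by (auto simp: \<psi>_def bij_betw_def)
    have \<psi>D: "\<psi> x \<in> D \<longleftrightarrow> x \<in> D" for x
      by (simp add: \<psi>_def tD)
    have "inj_on \<psi> V"
    proof (rule inj_onI)
      fix x y assume xy: "x \<in> V" "y \<in> V" "\<psi> x = \<psi> y"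
      then have "x \<in> D \<longleftrightarrow> y \<in> D"
        using \<psi>D by metis
      then show "x = y"
        using xy t(1) by (auto simp: \<psi>_def bij_betw_def dest: inj_onD split: if_splits)
    qed
    then have bij\<psi>: "bij_betw \<psi> V V"
      using endo_inj_surj[OF fin] \<psi>V by (simp add: bij_betw_def image_subset_iff)
    have F\<psi>: "F x y \<longleftrightarrow> F (\<psi> x) (\<psi> y)" if "x \<in> V" "y \<in> V" for x y
    proof (cases "x \<in> D \<longleftrightarrow> y \<in> D")
      case True
      then show ?thesis
        using t(2) that by (auto simp: \<psi>_def)
    next
      case False
      then show ?thesis
        using D_step \<psi>D by metis
    qed
    have side\<psi>: "side (\<psi> (f z)) = (if f z \<in> D then side z else side (f z))" if "z \<in> V" for z
      using flipped[of "f z"] t(3)[OF fV[OF that]] that by (auto simp: \<psi>_def)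
    have "{z \<in> V. side ((\<psi> \<circ> f) z) \<noteq> side z} \<subset> {z \<in> V. side (f z) \<noteq> side z}"
    proof (rule psubsetI)
      show "{z \<in> V. side ((\<psi> \<circ> f) z) \<noteq> side z} \<subseteq> {z \<in> V. side (f z) \<noteq> side z}"
        using side\<psi> by (auto split: if_splits)
      have "f w \<in> D"
        by (simp add: D_def)
      then have "w \<notin> {z \<in> V. side ((\<psi> \<circ> f) z) \<noteq> side z}"
        using side\<psi>[OF w(1)] by simp
      then show "{z \<in> V. side ((\<psi> \<circ> f) z) \<noteq> side z} \<noteq> {z \<in> V. side (f z) \<noteq> side z}"
        using w by blast
    qed
    then have "card {z \<in> V. side ((\<psi> \<circ> f) z) \<noteq> side z} < card {z \<in> V. side (f z) \<noteq> side z}"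
      by (rule psubset_card_mono[rotated]) (use fin in simp)
    then show ?thesis
    proof (rule less.hyps)
      show "bij_betw (\<psi> \<circ> f) V V"
        by (rule bij_betw_trans[OF f(1) bij\<psi>])
      show "\<forall>u\<in>V. \<forall>v\<in>V. E u v \<longleftrightarrow> F ((\<psi> \<circ> f) u) ((\<psi> \<circ> f) v)"
        using f(2) F\<psi> fV by simp
    qed
  qed
qed

section \<open>Groups of colour-preserving automorphisms and the conjugation argument\<close>

definition colour_auts :: "'v set \<Rightarrow> ('v \<Rightarrow> 'c) \<Rightarrow> ('v \<Rightarrow> 'v \<Rightarrow> bool) \<Rightarrow> ('v \<Rightarrow> 'v) set"
  where "colour_auts V c E = {f \<in> Bij V. (\<forall>v\<in>V. c (f v) = c v) \<and> (\<forall>u\<in>V. \<forall>v\<in>V. E u v \<longleftrightarrow> E (f u) (f v))}"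

lemma subgroup_colour_auts: "subgroup (colour_auts V c E) (BijGroup V)"
proof -
  interpret group "BijGroup V"
    by (rule group_BijGroup)
  have V: "f v \<in> V" if "f \<in> Bij V" "v \<in> V" for f v
    using that Bij_imp_funcset by blast
  show ?thesis
  proof (rule subgroupI)
    show "colour_auts V c E \<subseteq> carrier (BijGroup V)"
      by (auto simp: colour_auts_def BijGroup_def)
    have "(\<lambda>x\<in>V. x) \<in> colour_auts V c E"
      by (auto simp: colour_auts_def id_Bij)
    then show "colour_auts V c E \<noteq> {}"
      by blast
  next
    fix f assume f: "f \<in> colour_auts V c E"
    let ?g = "\<lambda>x\<in>V. inv_into V f x"
    have fB: "f \<in> Bij V"
      using f by (simp add: colour_auts_def)
    have cf: "\<forall>v\<in>V. c (f v) = c v" and Ef: "\<forall>u\<in>V. \<forall>v\<in>V. E u v \<longleftrightarrow> E (f u) (f v)"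
      using f by (simp_all add: colour_auts_def)
    have r: "f (?g v) = v" if "v \<in> V" for v
      using that fB by (simp add: Bij_def bij_betw_def f_inv_into_f)
    have gB: "?g \<in> Bij V"
      by (rule restrict_inv_into_Bij[OF fB])
    have "?g \<in> colour_auts V c E"
      unfolding colour_auts_def
    proof (intro CollectI conjI gB ballI)
      fix v assume v: "v \<in> V"
      show "c (?g v) = c v"
        using bspec[OF cf V[OF gB v]] r[OF v] by simp
      fix u assume u: "u \<in> V"
      show "E v u \<longleftrightarrow> E (?g v) (?g u)"
        using bspec[OF bspec[OF Ef V[OF gB v]] V[OF gB u]] r[OF v] r[OF u] by simp
    qed
    then show "inv\<^bsub>BijGroup V\<^esub> f \<in> colour_auts V c E"
      using inv_BijGroup[OF fB] by simp
  next
    fix f g assume f: "f \<in> colour_auts V c E" and g: "g \<in> colour_auts V c E"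
    then have B: "f \<in> Bij V" "g \<in> Bij V"
      by (simp_all add: colour_auts_def)
    have "compose V f g \<in> colour_auts V c E"
      using f g V[OF B(2)] by (simp add: colour_auts_def compose_Bij compose_eq)
    then show "f \<otimes>\<^bsub>BijGroup V\<^esub> g \<in> colour_auts V c E"
      using B by (simp add: BijGroup_def)
  qed
qed

lemma BijGroup_pow:
  assumes "f \<in> Bij V" "v \<in> V"
  shows "(f [^]\<^bsub>BijGroup V\<^esub> (n::nat)) v = (f ^^ n) v"
proof -
  interpret group "BijGroup V"
    by (rule group_BijGroup)
  have carrier: "carrier (BijGroup V) = Bij V"
    by (simp add: BijGroup_def)
  have mult: "(g \<otimes>\<^bsub>BijGroup V\<^esub> h) u = g (h u)" if "g \<in> Bij V" "h \<in> Bij V" "u \<in> V" for g h u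
    using that by (simp add: BijGroup_def compose_eq)
  show ?thesis
    using assms(2)
  proof (induction n arbitrary: v)
    case 0
    then show ?case
      by (simp add: BijGroup_def)
  next
    case (Suc n)
    have fn: "f [^]\<^bsub>BijGroup V\<^esub> n \<in> Bij V"
      using nat_pow_closed[of f n] assms(1) carrier by simp
    have "f v \<in> V"
      using assms(1) Suc.prems Bij_imp_funcset by blast
    then show ?case
      using Suc fn assms(1) by (simp add: mult funpow_swap1)
  qed
qed

lemma group_action_BijGroup: "group_action (BijGroup V) V (\<lambda>f. f)"
  unfolding group_action_def group_hom_def group_hom_axioms_def
  by (auto intro: group_BijGroup homI)

text \<open>Both \<open>a\<close> and its conjugate by \<open>f\<close> are automorphisms of
  \<open>E\<close> that preserve colours, and orbits lie inside colour classes, so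
  \<open>conjugate_piecewise_power\<close> applies. Correcting \<open>f\<close> by the automorphism
  found there makes the conjugate of \<open>a\<close> act as a power of \<open>a\<close> on each
  orbit of \<open>a\<close>.\<close>

lemma isomorphism_intertwining_powers:
  fixes V :: "'v set" and c :: "'v \<Rightarrow> 'c" and E F :: "'v \<Rightarrow> 'v \<Rightarrow> bool"
  assumes fin: "finite V" and p: "prime p" and small: "\<And>k. card {v \<in> V. c v = k} < p\<^sup>2"
    and f: "bij_betw f V V" "\<forall>v\<in>V. c (f v) = c v" "\<forall>u\<in>V. \<forall>v\<in>V. E u v \<longleftrightarrow> F (f u) (f v)"
    and a: "bij_betw a V V" "\<forall>v\<in>V. c (a v) = c v" "\<forall>u\<in>V. \<forall>v\<in>V. E u v \<longleftrightarrow> E (a u) (a v)"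
      "\<forall>u\<in>V. \<forall>v\<in>V. F u v \<longleftrightarrow> F (a u) (a v)"
      "\<forall>v\<in>V. a v \<noteq> v" "\<forall>v\<in>V. (a ^^ p) v = v"
  obtains h where "bij_betw h V V" "\<forall>v\<in>V. c (h v) = c v" "\<forall>u\<in>V. \<forall>v\<in>V. E u v \<longleftrightarrow> F (h u) (h v)"
    "\<forall>w\<in>V. \<exists>i. \<forall>n. a (h ((a ^^ n) w)) = h ((a ^^ (n + i)) w)"
proof -
  let ?A = "colour_auts V c E"
  let ?G = "(BijGroup V)\<lparr>carrier := ?A\<rparr>"
  interpret B: group "BijGroup V"
    by (rule group_BijGroup)
  interpret G: group ?G
    by (rule B.subgroup_imp_group[OF subgroup_colour_auts])
  interpret G: group_action ?G V "\<lambda>f. f"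
    by (rule group_action.induced_action[OF group_action_BijGroup subgroup_colour_auts])
  have pow: "(g [^]\<^bsub>?G\<^esub> (n::nat)) v = (g ^^ n) v" if "g \<in> ?A" "v \<in> V" for g n v
    using that BijGroup_pow[of g V v n]
    by (simp add: colour_auts_def flip: B.nat_pow_consistent)
  have aV: "a v \<in> V" and fV: "f v \<in> V" if "v \<in> V" for v
    using a(1) f(1) that by (auto simp: bij_betw_def)
  let ?f' = "inv_into V f"
  have f'V: "?f' v \<in> V" and ff': "f (?f' v) = v" and f'f: "?f' (f v) = v" if "v \<in> V" for v
    using f(1) that by (auto simp: bij_betw_def inv_into_into f_inv_into_f)
  have anV: "(a ^^ n) v \<in> V" if "v \<in> V" for v n
    using that by (induction n) (auto simp: aV)
  \<comment> \<open>Elements of \<open>Bij V\<close> must be undefined outside \<open>V\<close>,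
    hence the restrictions in \<open>x\<close> and \<open>y\<close>.\<close>
  define x where "x = restrict a V"
  define y where "y = (\<lambda>v\<in>V. ?f' (a (f v)))"
  have "x \<in> ?A"
    unfolding colour_auts_def Bij_def x_def using a(1-3) aV by (simp cong: bij_betw_cong)
  have "bij_betw (?f' \<circ> (a \<circ> f)) V V"
    by (intro bij_betw_trans[OF _ bij_betw_inv_into[OF f(1)]] bij_betw_trans[OF f(1) a(1)])
  then have "bij_betw y V V"
    by (rule bij_betw_cong[THEN iffD1, rotated]) (simp add: y_def)
  moreover have "c (y v) = c v" if "v \<in> V" for v
    using that f(2) a(2) by (metis aV f'V fV ff' restrict_apply' y_def)
  moreover have "E u v \<longleftrightarrow> E (y u) (y v)" if "u \<in> V" "v \<in> V" for u v
    using that f(3) a(4) by (simp add: y_def aV fV f'V ff')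
  ultimately have "y \<in> ?A"
    by (simp add: colour_auts_def Bij_def) (simp add: y_def)
  have xn: "(x ^^ n) v = (a ^^ n) v" if "v \<in> V" for n v
    using that by (induction n) (auto simp: x_def anV)
  have yn: "(y ^^ n) v = ?f' ((a ^^ n) (f v))" if "v \<in> V" for n v
    using that by (induction n) (auto simp: y_def anV fV f'V ff' f'f)
  have one: "g = \<one>\<^bsub>?G\<^esub>" if "g \<in> ?A" "\<And>v. v \<in> V \<Longrightarrow> g v = v" for g
    using that by (auto simp: BijGroup_def colour_auts_def Bij_def extensional_def)
  have xp: "x [^]\<^bsub>?G\<^esub> p = \<one>\<^bsub>?G\<^esub>"
    by (rule one) (use G.nat_pow_closed[of x p] \<open>x \<in> ?A\<close> a(6) in \<open>simp_all add: pow xn\<close>)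
  have yp: "y [^]\<^bsub>?G\<^esub> p = \<one>\<^bsub>?G\<^esub>"
    by (rule one) (use G.nat_pow_closed[of y p] \<open>y \<in> ?A\<close> a(6) in \<open>simp_all add: pow yn fV f'f\<close>)
  have finA: "finite (carrier ?G)"
    unfolding partial_object.update_convs partial_object.select_convs
    by (rule finite_subset[OF _ finite_PiE[OF fin fin]])
      (auto simp: colour_auts_def Bij_def PiE_def bij_betw_def)
  have orb: "card (orbit ?G (\<lambda>f. f) w) < p\<^sup>2" if w: "w \<in> V" for w
  proof -
    have "orbit ?G (\<lambda>f. f) w \<subseteq> {v \<in> V. c v = c w}"
      using w Bij_imp_funcset by (fastforce simp: orbit_def colour_auts_def)
    then have "card (orbit ?G (\<lambda>f. f) w) \<le> card {v \<in> V. c v = c w}"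
      by (rule card_mono[rotated]) (use fin in simp)
    then show ?thesis
      using small[of "c w"] by simp
  qed
  have free: "x w \<noteq> w" if "w \<in> V" for w
    using that a(5) by (simp add: x_def)
  have xG: "x \<in> carrier ?G" and yG: "y \<in> carrier ?G"
    using \<open>x \<in> ?A\<close> \<open>y \<in> ?A\<close> by simp_all
  obtain g where "g \<in> carrier ?G" and g2:
    "\<And>w. w \<in> V \<Longrightarrow> \<exists>i::nat. \<forall>n::nat.
      (g \<otimes>\<^bsub>?G\<^esub> y \<otimes>\<^bsub>?G\<^esub> inv\<^bsub>?G\<^esub> g) ((x [^]\<^bsub>?G\<^esub> n) w) = (x [^]\<^bsub>?G\<^esub> (n + i)) w"
    by (rule G.conjugate_piecewise_power[OF finA fin p xG xp yG yp orb free]) blast+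
  then have g: "g \<in> ?A"
    by simp
  let ?g' = "inv\<^bsub>?G\<^esub> g"
  have g'A: "?g' \<in> ?A"
    using G.inv_closed[of g] g by simp
  have g'V: "?g' v \<in> V" if "v \<in> V" for v
    using G.element_image[of ?g' v] g'A that by simp
  have g'g: "?g' (g v) = v" if "v \<in> V" for v
    using G.orbit_sym_aux[of g v "g v"] g that by simp
  have comp: "(g1 \<otimes>\<^bsub>?G\<^esub> g2) v = g1 (g2 v)" if "g1 \<in> ?A" "g2 \<in> ?A" "v \<in> V" for g1 g2 v
    using G.composition_rule[of v g1 g2] that by simp
  have yV: "y v \<in> V" if "v \<in> V" for v
    using that by (simp add: y_def f'V aV fV)
  have g'c: "\<forall>v\<in>V. c (?g' v) = c v" and g'E: "\<forall>u\<in>V. \<forall>v\<in>V. E u v \<longleftrightarrow> E (?g' u) (?g' v)"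
    using g'A unfolding colour_auts_def by blast+
  show thesis
  \<comment> \<open>From a f = f y on \<open>V\<close>, the map h = f g^-1 satisfies a h = h (g y
    g^-1), and g y g^-1 is piecewise a power of \<open>a\<close>.\<close>
  proof (rule that[of "f \<circ> ?g'"])
    have "bij_betw ?g' V V"
      using g'A unfolding colour_auts_def Bij_def by blast
    then show "bij_betw (f \<circ> ?g') V V"
      using f(1) by (rule bij_betw_trans)
    show "\<forall>v\<in>V. c ((f \<circ> ?g') v) = c v"
      using f(2) g'c g'V by simp
    show "\<forall>u\<in>V. \<forall>v\<in>V. E u v \<longleftrightarrow> F ((f \<circ> ?g') u) ((f \<circ> ?g') v)"
    proof (intro ballI)
      fix u v assume u: "u \<in> V" and v: "v \<in> V"
      have "E u v \<longleftrightarrow> E (?g' u) (?g' v)"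
        using g'E u v by blast
      also have "\<dots> \<longleftrightarrow> F (f (?g' u)) (f (?g' v))"
        using f(3) g'V[OF u] g'V[OF v] by blast
      finally show "E u v \<longleftrightarrow> F ((f \<circ> ?g') u) ((f \<circ> ?g') v)"
        by simp
    qed
    show "\<forall>w\<in>V. \<exists>i. \<forall>n. a ((f \<circ> ?g') ((a ^^ n) w)) = (f \<circ> ?g') ((a ^^ (n + i)) w)"
    proof
      fix w assume w: "w \<in> V"
      obtain i :: nat where i: "\<And>n::nat. (g \<otimes>\<^bsub>?G\<^esub> y \<otimes>\<^bsub>?G\<^esub> ?g') ((x [^]\<^bsub>?G\<^esub> n) w) = (x [^]\<^bsub>?G\<^esub> (n + i)) w"
        using g2[OF w] by blast
      have "a ((f \<circ> ?g') ((a ^^ n) w)) = (f \<circ> ?g') ((a ^^ (n + i)) w)" for n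
      proof -
        let ?u = "(a ^^ n) w"
        have u: "?u \<in> V"
          by (rule anV[OF w])
        have gy: "g \<otimes>\<^bsub>?G\<^esub> y \<in> ?A"
          using G.m_closed[of g y] g \<open>y \<in> ?A\<close> by simp
        have "g (y (?g' ?u)) = (a ^^ (n + i)) w"
          using i[of n] by (simp only: pow[OF \<open>x \<in> ?A\<close> w] xn[OF w] comp[OF gy g'A u]
            comp[OF g \<open>y \<in> ?A\<close> g'V[OF u]])
        then have "?g' (g (y (?g' ?u))) = ?g' ((a ^^ (n + i)) w)"
          by simp
        then have "y (?g' ?u) = ?g' ((a ^^ (n + i)) w)"
          by (simp only: g'g yV g'V u)
        then have "f (y (?g' ?u)) = f (?g' ((a ^^ (n + i)) w))"
          by simp
        then show ?thesis
          by (simp add: y_def g'V u ff' aV fV)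
      qed
      then show "\<exists>i. \<forall>n. a ((f \<circ> ?g') ((a ^^ n) w)) = (f \<circ> ?g') ((a ^^ (n + i)) w)"
        by blast
    qed
  qed
qed

section \<open>Bi-Cayley graphs of cyclic groups\<close>

lemma parcs_bi_cayley_integer_mod_group_iff:
  assumes "n > 0" "S \<subseteq> {0..<int n}"
  shows "(u, v) \<in> parcs (bi_cayley (integer_mod_group n) S) \<longleftrightarrow>
    u \<in> {0..<int n} \<times> {1, 2} \<and> v \<in> {0..<int n} \<times> {1, 2} \<and>
    (snd u = 1 \<and> snd v = 2 \<and> (fst v - fst u) mod int n \<in> S \<or>
     snd u = 2 \<and> snd v = 1 \<and> (fst u - fst v) mod int n \<in> S)"
    (is "?L \<longleftrightarrow> ?R")
proof
  assume ?L
  then obtain g s where "g \<in> {0..<int n}" and s: "s \<in> S"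
    and uv: "(u, v) = ((g, 1), ((s + g) mod int n, 2)) \<or> (u, v) = (((s + g) mod int n, 2), (g, 1))"
    using assms(1) by (auto simp: bi_cayley_def carrier_integer_mod_group)
  moreover have "((s + g) mod int n - g) mod int n = s"
    using s assms(2) by (auto simp: mod_diff_left_eq)
  ultimately show ?R
    using assms(1) by auto
next
  assume ?R
  have "((y - x) mod int n + x) mod int n = y" if "y \<in> {0..<int n}" for x y
    using that by (simp add: mod_add_left_eq)
  then have arc: "((x, 1), (y, 2)) \<in> parcs (bi_cayley (integer_mod_group n) S)"
    "((y, 2), (x, 1)) \<in> parcs (bi_cayley (integer_mod_group n) S)"
    if "x \<in> {0..<int n}" "y \<in> {0..<int n}" "(y - x) mod int n \<in> S" for x y
    using that assms(1) unfolding bi_cayley_def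
    by (force simp: carrier_integer_mod_group intro!: bexI[of _ x] bexI[of _ "(y - x) mod int n"])+
  obtain x i y j where uv: "u = (x, i)" "v = (y, j)"
    by (cases u; cases v)
  have x: "x \<in> {0..<int n}" and y: "y \<in> {0..<int n}"
    using \<open>?R\<close> uv by simp_all
  consider "i = 1" "j = 2" "(y - x) mod int n \<in> S" | "i = 2" "j = 1" "(x - y) mod int n \<in> S"
    using \<open>?R\<close> uv by auto
  then show ?L
    using arc[OF x y] arc[OF y x] by cases (simp_all only: uv)
qed

text \<open>As \<open>T\<close> is not empty, no vertex is isolated. A reflection negates
  differences and exchanges the sides, and these two effects cancel in the adjacency
  relation.\<close>

lemma bi_cayley_side_preserving_isomorphism:
  fixes n :: nat and S T :: "int set"
  defines "V \<equiv> {0..<int n} \<times> {1, 2::nat}"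
  defines "arc \<equiv> \<lambda>S u v. (u, v) \<in> parcs (bi_cayley (integer_mod_group n) S)"
  assumes n: "n > 0" and S: "S \<subseteq> {0..<int n}" and T: "T \<subseteq> {0..<int n}" "T \<noteq> {}"
    and f: "bij_betw f V V" "\<forall>u\<in>V. \<forall>v\<in>V. arc S u v \<longleftrightarrow> arc T (f u) (f v)"
  shows "\<exists>f. bij_betw f V V \<and> (\<forall>u\<in>V. \<forall>v\<in>V. arc S u v \<longleftrightarrow> arc T (f u) (f v)) \<and>
    (\<forall>v\<in>V. snd (f v) = snd v)"
proof -
  note arcS = parcs_bi_cayley_integer_mod_group_iff[OF n S, folded V_def]
  note arcT = parcs_bi_cayley_integer_mod_group_iff[OF n T(1), folded V_def]
  have "\<exists>f. bij_betw f V V \<and> (\<forall>u\<in>V. \<forall>v\<in>V. arc S u v \<longleftrightarrow> arc T (f u) (f v)) \<and>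
    (\<forall>v\<in>V. (snd (f v) = 1) = (snd v = 1))"
  proof (rule side_preserving_isomorphism[OF _ _ _ _ _ _ _ f])
    show "finite V"
      by (simp add: V_def)
    show "\<exists>u. arc T v u" if "v \<in> V" for v
    proof -
      obtain s where s: "s \<in> T"
        using T(2) by blast
      then have "s mod int n = s"
        using T(1) by auto
      then have "((fst v + s) mod int n - fst v) mod int n = s"
        "(fst v - (fst v - s) mod int n) mod int n = s"
        by (simp_all add: mod_diff_left_eq mod_diff_right_eq)
      then have "arc T v ((fst v + s) mod int n, 2) \<or> arc T v ((fst v - s) mod int n, 1)"
        using that s n unfolding arc_def arcT by (auto simp: V_def)
      then show ?thesis
        by blast
    qed
  next
    fix u v assume uv: "arc T u v"
    \<comment> \<open>The centre is chosen so that the reflection exchanges the ends of the given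
      edge; \<open>3 - snd x\<close> swaps the sides 1 and 2.\<close>
    define t where "t = (\<lambda>x :: int \<times> nat. ((fst u + fst v - fst x) mod int n, 3 - snd x))"
    have tt: "t (t x) = x" "t x \<in> V" if "x \<in> V" for x
      using that n by (auto simp: t_def V_def mod_diff_right_eq)
    have "bij_betw t V V"
      by (rule bij_betw_byWitness[where f' = t]) (use tt in auto)
    moreover have "arc T x y \<longleftrightarrow> arc T (t x) (t y)" if "x \<in> V" "y \<in> V" for x y
    proof -
      have d: "(fst (t x) - fst (t y)) mod int n = (fst y - fst x) mod int n" for x y
        by (simp add: t_def mod_diff_eq)
      have "snd (t x) = 3 - snd x" "snd (t y) = 3 - snd y"
        by (simp_all add: t_def)
      moreover have "snd x = 1 \<or> snd x = 2" "snd y = 1 \<or> snd y = 2"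
        using that by (auto simp: V_def)
      ultimately show ?thesis
        using that tt(2)[OF that(1)] tt(2)[OF that(2)] unfolding arc_def arcT d by auto
    qed
    moreover have "t u = v" "t v = u"
      using uv unfolding arc_def arcT by (auto simp: t_def V_def prod_eq_iff)
    ultimately show "\<exists>t. bij_betw t V V \<and> (\<forall>x\<in>V. \<forall>y\<in>V. arc T x y \<longleftrightarrow> arc T (t x) (t y)) \<and>
      (\<forall>x\<in>V. (snd (t x) = 1) \<noteq> (snd x = 1)) \<and> t u = v \<and> t v = u"
      by (intro exI[of _ t]) (auto simp: t_def V_def)
  qed (auto simp: arc_def arcS arcT)
  then obtain f where f: "bij_betw f V V" "\<forall>u\<in>V. \<forall>v\<in>V. arc S u v \<longleftrightarrow> arc T (f u) (f v)"
    "\<forall>v\<in>V. (snd (f v) = 1) = (snd v = 1)"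
    by blast
  have "snd (f v) = snd v" if "v \<in> V" for v
  proof -
    have "f v \<in> V"
      using f(1) that by (auto simp: bij_betw_def)
    then show ?thesis
      using f(3) that by (auto simp: V_def)
  qed
  then show ?thesis
    using f by blast
qed

text \<open>The sides serve as colours, and each has \<open>2 * p\<close> vertices, fewer than
  \<open>p\<^sup>2\<close> because \<open>p\<close> is at least 3. Adding 2 on both sides preserves
  differences, moves every vertex and has \<open>p\<close>-th power the identity, so it can play the
  part of \<open>a\<close>.\<close>

lemma bi_cayley_isomorphism_shift:
  fixes p :: nat and S T :: "int set"
  defines "V \<equiv> {0..<int (2 * p)} \<times> {1, 2::nat}"
  defines "arc \<equiv> \<lambda>S u v. (u, v) \<in> parcs (bi_cayley (integer_mod_group (2 * p)) S)"
  assumes p: "prime p" "odd p" and S: "S \<subseteq> {0..<int (2 * p)}" and T: "T \<subseteq> {0..<int (2 * p)}"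
    and f: "bij_betw f V V" "\<forall>u\<in>V. \<forall>v\<in>V. arc S u v \<longleftrightarrow> arc T (f u) (f v)"
      "\<forall>v\<in>V. snd (f v) = snd v"
  obtains h where "bij_betw h V V" "\<forall>v\<in>V. snd (h v) = snd v"
    "\<forall>u\<in>V. \<forall>v\<in>V. arc S u v \<longleftrightarrow> arc T (h u) (h v)"
    "\<And>x s. (x, s) \<in> V \<Longrightarrow> \<exists>i::nat. \<forall>n::nat.
      fst (h ((x + 2 * (int n + int i)) mod int (2 * p), s)) =
      (fst (h ((x + 2 * int n) mod int (2 * p), s)) + 2) mod int (2 * p)"
proof -
  let ?N = "int (2 * p)"
  have p3: "p \<ge> 3"
    using p prime_ge_2_nat[of p] by (cases "p = 2") auto
  have N: "2 * p > 0"
    using p3 by simp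
  define a where "a = (\<lambda>v :: int \<times> nat. ((fst v + 2) mod ?N, snd v))"
  have aV: "a v \<in> V" if "v \<in> V" for v
    using that N by (auto simp: a_def V_def)
  have an: "(a ^^ n) (x, s) = ((x + 2 * int n) mod ?N, s)" if "(x, s) \<in> V" for n x s
  proof (induction n)
    case 0
    then show ?case
      using that by (auto simp: V_def)
  next
    case (Suc n)
    then show ?case
      by (simp add: a_def mod_add_left_eq mod_add_right_eq algebra_simps)
  qed
  have ap: "(a ^^ p) v = v" if "v \<in> V" for v
    using an[of "fst v" "snd v" p] that by (auto simp: V_def)
  have fin: "finite V"
    by (simp add: V_def)
  have "a ` V = V"
  proof
    show "a ` V \<subseteq> V"
      using aV by blast
    have "(a ^^ n) v \<in> V" if "v \<in> V" for n v
      using that by (induction n) (auto intro: aV)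
    moreover have "a ((a ^^ (p - 1)) v) = v" if "v \<in> V" for v
      using ap[OF that] p3 by (cases p) auto
    ultimately show "V \<subseteq> a ` V"
      by (metis image_eqI subsetI)
  qed
  then have a_bij: "bij_betw a V V"
    using fin by (simp add: bij_betw_def eq_card_imp_inj_on)
  have a_arc: "\<forall>u\<in>V. \<forall>v\<in>V. arc R u v \<longleftrightarrow> arc R (a u) (a v)" if "R \<subseteq> {0..<?N}" for R
  proof (intro ballI)
    fix u v assume uv: "u \<in> V" "v \<in> V"
    note arcR = parcs_bi_cayley_integer_mod_group_iff[OF N that, folded V_def]
    have d: "(fst (a x) - fst (a y)) mod ?N = (fst x - fst y) mod ?N" for x y
      by (simp add: a_def mod_diff_eq)
    show "arc R u v \<longleftrightarrow> arc R (a u) (a v)"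
      using uv aV unfolding arc_def arcR d by (simp add: a_def)
  qed
  have small: "card {v \<in> V. snd v = k} < p\<^sup>2" for k
  proof -
    have "{v \<in> V. snd v = k} \<subseteq> {0..<?N} \<times> {k}"
      by (auto simp: V_def)
    then have "card {v \<in> V. snd v = k} \<le> card ({0..<?N} \<times> {k})"
      by (rule card_mono[rotated]) simp
    also have "\<dots> = 2 * p"
      by (simp add: card_cartesian_product)
    also have "\<dots> < p\<^sup>2"
      using p3 by (simp add: power2_eq_square)
    finally show ?thesis .
  qed
  have free: "\<forall>v\<in>V. a v \<noteq> v"
  proof (intro ballI notI)
    fix v
    assume "a v = v"
    then have "(fst v + 2) mod ?N = fst v"
      by (metis a_def fst_conv)
    then have "?N dvd 2"
      by (metis add_diff_cancel_left' mod_eq_dvd_iff mod_mod_trivial)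
    then show False
      using p3 by (auto dest: zdvd_imp_le)
  qed
  have a_snd: "\<forall>v\<in>V. snd (a v) = snd v" and a_pow: "\<forall>v\<in>V. (a ^^ p) v = v"
    using ap by (simp_all add: a_def)
  obtain h where h: "bij_betw h V V" "\<forall>v\<in>V. snd (h v) = snd v"
    "\<forall>u\<in>V. \<forall>v\<in>V. arc S u v \<longleftrightarrow> arc T (h u) (h v)"
    "\<forall>w\<in>V. \<exists>i. \<forall>n. a (h ((a ^^ n) w)) = h ((a ^^ (n + i)) w)"
    by (rule isomorphism_intertwining_powers[OF fin p(1) small f(1) f(3) f(2) a_bij a_snd
          a_arc[OF S] a_arc[OF T] free a_pow])
  show thesis
  proof (rule that[OF h(1-3)])
    fix x s assume xs: "(x, s) \<in> V"
    obtain i where i: "\<And>n. a (h ((a ^^ n) (x, s))) = h ((a ^^ (n + i)) (x, s))"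
      using h(4) xs by blast
    have "fst (h ((x + 2 * (int n + int i)) mod ?N, s)) =
      (fst (h ((x + 2 * int n) mod ?N, s)) + 2) mod ?N" for n
      using arg_cong[OF i[of n, symmetric], of fst] by (simp only: an[OF xs] of_nat_add) (simp add: a_def)
    then show "\<exists>i::nat. \<forall>n::nat. fst (h ((x + 2 * (int n + int i)) mod ?N, s)) =
      (fst (h ((x + 2 * int n) mod ?N, s)) + 2) mod ?N"
      by blast
  qed
qed

section \<open>Affine maps of the cyclic group and its bi-Cayley isomorphisms\<close>

lemma mult_mod_auto:
  assumes n: "n > 0" and m: "coprime m (int n)"
  shows "(\<lambda>z\<in>{0..<int n}. m * z mod int n) \<in> auto (integer_mod_group n)"
proof -
  let ?f = "\<lambda>z\<in>{0..<int n}. m * z mod int n"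
  have C: "carrier (integer_mod_group n) = {0..<int n}"
    using n by (simp add: carrier_integer_mod_group)
  have inj: "inj_on ?f {0..<int n}"
  proof (rule inj_onI)
    fix x y assume x: "x \<in> {0..<int n}" and y: "y \<in> {0..<int n}" and "?f x = ?f y"
    then have "[m * x = m * y] (mod int n)"
      by (simp add: cong_def)
    then have "[x = y] (mod int n)"
      using m by (simp add: cong_mult_lcancel)
    then show "x = y"
      using x y by (simp add: cong_def)
  qed
  moreover have "?f ` {0..<int n} \<subseteq> {0..<int n}"
    using n by auto
  ultimately have "bij_betw ?f {0..<int n} {0..<int n}"
    by (simp add: bij_betw_def endo_inj_surj)
  moreover have "?f \<in> hom (integer_mod_group n) (integer_mod_group n)"
    by (rule homI) (use n in \<open>auto simp: C mod_simps distrib_left\<close>)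
  ultimately show ?thesis
    by (simp add: auto_def Bij_def C)
qed

theorem theorem5:
  fixes p :: nat
  assumes "prime p" and "odd p"
  shows "bci_group (integer_mod_group (2 * p))"
proof -
  let ?Z = "integer_mod_group (2 * p)"
  let ?N = "int (2 * p)"
  let ?V = "{0..<?N} \<times> {1, 2::nat}"
  let ?arc = "\<lambda>S u v. (u, v) \<in> parcs (bi_cayley ?Z S)"
  have N: "2 * p > 0"
    using assms(1) prime_gt_0_nat by simp
  have C: "carrier ?Z = {0..<?N}"
    using N by (simp add: carrier_integer_mod_group)
  have "\<exists>g\<in>carrier ?Z. \<exists>\<alpha>\<in>auto ?Z. T = g <#\<^bsub>?Z\<^esub> (\<alpha> ` S)"
    if S: "S \<subseteq> {0..<?N}" and T: "T \<subseteq> {0..<?N}"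
      and iso: "digraph_iso (bi_cayley ?Z S) (bi_cayley ?Z T)" for S T
  proof -
    note arc_iff = parcs_bi_cayley_integer_mod_group_iff[OF N]
    have wf: "pair_wf_digraph (bi_cayley ?Z R)" if "R \<subseteq> {0..<?N}" for R
    proof -
      interpret pair_graph "bi_cayley ?Z R"
        by (rule pair_graph_bi_cayley) (use that C in simp_all)
      show ?thesis
        by unfold_locales
    qed
    have "pverts (bi_cayley ?Z R) = ?V" for R
      using C by (simp add: bi_cayley_def)
    then obtain f0 where f0: "bij_betw f0 ?V ?V"
      "\<forall>u\<in>?V. \<forall>v\<in>?V. ?arc S u v \<longleftrightarrow> ?arc T (f0 u) (f0 v)"
      using iso digraph_iso_with_proj_iff[OF wf[OF S] wf[OF T]] by auto
    show ?thesis
    \<comment> \<open>The empty graph is set apart because its vertices are isolated, which the side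
      correction excludes.\<close>
    proof (cases "T = {}")
      case True
      have "S = {}"
      proof (rule ccontr)
        assume "S \<noteq> {}"
        then obtain s where s: "s \<in> S"
          by blast
        then have "?arc S (0, 1) (s, 2)"
          unfolding arc_iff[OF S] using S N by auto
        moreover from this have "(0, 1) \<in> ?V" "(s, 2) \<in> ?V"
          unfolding arc_iff[OF S] by blast+
        ultimately have "?arc T (f0 (0, 1)) (f0 (s, 2))"
          using f0(2) by blast
        then show False
          using True by (simp add: bi_cayley_def)
      qed
      then show ?thesis
        using True N C group.id_in_auto[of ?Z] by (auto simp: l_coset_def)
    next
      case False
      obtain f where f: "bij_betw f ?V ?V" "\<forall>u\<in>?V. \<forall>v\<in>?V. ?arc S u v \<longleftrightarrow> ?arc T (f u) (f v)"
        "\<forall>v\<in>?V. snd (f v) = snd v"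
        using bi_cayley_side_preserving_isomorphism[OF N S T False f0] by blast
      obtain h where h: "bij_betw h ?V ?V" "\<forall>v\<in>?V. snd (h v) = snd v"
        "\<forall>u\<in>?V. \<forall>v\<in>?V. ?arc S u v \<longleftrightarrow> ?arc T (h u) (h v)"
        "\<And>x s. (x, s) \<in> ?V \<Longrightarrow> \<exists>i::nat. \<forall>n::nat.
          fst (h ((x + 2 * (int n + int i)) mod ?N, s)) =
          (fst (h ((x + 2 * int n) mod ?N, s)) + 2) mod ?N"
        using bi_cayley_isomorphism_shift[OF assms S T f] by metis
      \<comment> \<open>The first coordinate of \<open>h\<close> on side \<open>s\<close>, extended
        to a function on all integers with period \<open>2 * p\<close>.\<close>
      define H where "H s x = fst (h (x mod ?N, s))" for s x
      have V: "(x mod ?N, s) \<in> ?V" if "s \<in> {1, 2}" for x s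
        using that N by auto
      have hH: "h (x mod ?N, s) = (H s x, s)" if "s \<in> {1, 2}" for x s
        using bspec[OF h(2) V[OF that, of x]] by (simp add: H_def prod_eq_iff)
      have H_range: "H s x \<in> {0..<?N}" if "s \<in> {1, 2}" for x s
        using h(1) V[OF that, of x] hH[OF that, of x] by (metis bij_betw_def imageI mem_Sigma_iff)
      have H_inj: "[x = y] (mod 2 * int p)" if "[H s x = H s y] (mod 2 * int p)" "s \<in> {1, 2}" for x y s
      proof -
        have "H s x = H s y"
          using that(1) H_range[OF that(2), of x] H_range[OF that(2), of y] by (simp add: cong_def)
        then have "h (x mod ?N, s) = h (y mod ?N, s)"
          using hH[OF that(2)] by simp
        then have "(x mod ?N, s) = (y mod ?N, s)"
          using h(1) V[OF that(2)] by (meson bij_betw_def inj_onD)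
        then show ?thesis
          by (simp add: cong_def)
      qed
      have H_affine: "\<exists>m. \<forall>j. [H s (e + 2 * j) = H s e + 2 * (m * j)] (mod 2 * int p)"
        if "s \<in> {1, 2}" "e \<in> {0, 1}" for s e
      proof -
        have "(e, s) \<in> ?V"
          using that N by auto
        then obtain i :: nat where i: "\<And>n::nat. fst (h ((e + 2 * (int n + int i)) mod ?N, s)) =
            (fst (h ((e + 2 * int n) mod ?N, s)) + 2) mod ?N"
          using h(4) by blast
        show ?thesis
        proof (rule affine_on_parity_class[where i = i])
          show "prime (int p)" "odd (int p)"
            using assms by simp_all
          show "H s x = H s y" if "[x = y] (mod 2 * int p)" for x y
            using that by (simp add: H_def cong_def)
          show "[H s (e + 2 * (int n + int i)) = H s (e + 2 * int n) + 2] (mod 2 * int p)" for n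
            using i[of n] by (simp add: H_def cong_def)
        qed
      qed
      have iso_int: "(y - x) mod ?N \<in> S \<longleftrightarrow> (H 2 y - H 1 x) mod ?N \<in> T" for x y
      proof -
        have "(y - x) mod ?N \<in> S \<longleftrightarrow> ?arc S (x mod ?N, 1) (y mod ?N, 2)"
          unfolding arc_iff[OF S] using V[of 1 x] V[of 2 y] by (simp add: mod_diff_eq)
        also have "\<dots> \<longleftrightarrow> ?arc T (H 1 x, 1) (H 2 y, 2)"
          using h(3) V[of 1 x] V[of 2 y] hH[of 1 x] hH[of 2 y] by auto
        also have "\<dots> \<longleftrightarrow> (H 2 y - H 1 x) mod ?N \<in> T"
          unfolding arc_iff[OF T] using H_range[of 1 x] H_range[of 2 y] by simp
        finally show ?thesis .
      qed
      obtain m t where m: "coprime m (2 * int p)"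
        and mt: "\<And>z. z mod ?N \<in> S \<longleftrightarrow> (m * z + t) mod ?N \<in> T"
      proof (rule piecewise_affine_imp_affine[of "int p" "\<lambda>z. z mod ?N \<in> T" "\<lambda>z. z mod ?N \<in> S" "H 2" "H 1"])
        show "prime (int p)" "odd (int p)"
          using assms by simp_all
        show "(x mod ?N \<in> T) = (y mod ?N \<in> T)" if "[x = y] (mod 2 * int p)" for x y
          using that by (simp add: cong_def)
      qed (use iso_int H_inj H_affine in auto)
      let ?\<alpha> = "\<lambda>z\<in>{0..<?N}. m * z mod ?N"
      have "T = (t mod ?N) <#\<^bsub>?Z\<^esub> (?\<alpha> ` S)"
      proof (rule Set.set_eqI)
        fix y
        have coset: "y \<in> (t mod ?N) <#\<^bsub>?Z\<^esub> (?\<alpha> ` S) \<longleftrightarrow> (\<exists>z\<in>S. y = (m * z + t) mod ?N)"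
          using S by (auto simp: l_coset_def mod_simps add.commute subset_iff)
        show "y \<in> T \<longleftrightarrow> y \<in> (t mod ?N) <#\<^bsub>?Z\<^esub> (?\<alpha> ` S)"
        proof
          assume y: "y \<in> T"
          \<comment> \<open>The inverse \<open>i\<close> of \<open>m\<close> gives the preimage
            \<open>i * (y - t)\<close> of \<open>y\<close> under the affine map.\<close>
          obtain i where "[m * i = 1] (mod 2 * int p)"
            using cong_solve_coprime_int[OF m] by blast
          then have "[m * i * (y - t) = 1 * (y - t)] (mod 2 * int p)"
            by (rule cong_mult) simp
          then have "[m * (i * (y - t)) + t = 1 * (y - t) + t] (mod 2 * int p)"
            by (intro cong_add) (simp_all add: mult.assoc)
          then have *: "(m * (i * (y - t)) + t) mod ?N = y"
            using y T by (auto simp: cong_def)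
          then have "(i * (y - t)) mod ?N \<in> S"
            using mt y by simp
          moreover have "y = (m * ((i * (y - t)) mod ?N) + t) mod ?N"
            by (subst * [symmetric], intro mod_add_cong mod_mult_right_eq[symmetric] refl)
          ultimately show "y \<in> (t mod ?N) <#\<^bsub>?Z\<^esub> (?\<alpha> ` S)"
            unfolding coset by blast
        next
          assume "y \<in> (t mod ?N) <#\<^bsub>?Z\<^esub> (?\<alpha> ` S)"
          then obtain z where "z \<in> S" "y = (m * z + t) mod ?N"
            unfolding coset by blast
          moreover from this have "z mod ?N = z"
            using S by auto
          ultimately show "y \<in> T"
            using mt[of z] by simp
        qed
      qed
      moreover have "?\<alpha> \<in> auto ?Z"
        using mult_mod_auto[OF N] m by simp
      moreover have "t mod ?N \<in> carrier ?Z"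
        using N C by simp
      ultimately show ?thesis
        by blast
    qed
  qed
  then show ?thesis
    unfolding bci_group_def bci_graph_def C by simp
qed

end
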